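(* Let $\mathcal{X}$ be a convex subset of $L^1$ with the following properties: (i) $\mathcal{X}+\mathcal{X}\subset\mathcal{X}$; (ii) $L^\infty\subset\mathcal{X}$, and $X\mathbb{1}_A\in\mathcal{X}$ for each $X\in\mathcal{X}$ and $A\in\mathcal{F}$. Let $\rho:\mathcal{X}\to(-\infty,\infty]$ be quasiconvex and law invariant with the Fatou property. Then the functional $\overline{\rho}:L^1\to(-\infty,\infty]$ defined by $$\overline{\rho}(X)=\sup_{\pi\in\Pi}\rho(\mathbb{E}[X|\pi]),\qquad X\in L^1,$$ agrees with $\rho$ on $\mathcal{X}$, and is quasiconvex, law invariant, dilatation monotone and $\sigma(L^1,\mathcal{L})$ lower semicontinuous. Moreover, $\overline{\rho}$ preserves monotonicity, convexity and cash-additivity of $\rho$ (that is, for each of these properties, if $\rho$ has it on $\mathcal{X}$ then $\overline{\rho}$ has it on $L^1$).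
   Context: $(\Omega,\mathcal{F},\mathbb{P})$ is a fixed nonatomic probability space; $L^1$ (resp. $L^\infty$) is the space of integrable (resp. bounded) random variables modulo a.s. equality; all (in)equalities between random variables are a.s. $\mathcal{L}$ is the space of simple random variables $\sum_{i=1}^n a_i\mathbb{1}_{A_i}$ ($n\in\mathbb{N}$, $a_i\in\mathbb{R}$, $A_i\in\mathcal{F}$). $\Pi$ is the collection of all finite measurable partitions of $\Omega$ whose members have nonzero probability, and $\mathbb{E}[X|\pi]:=\mathbb{E}[X|\sigma(\pi)]$ for $\pi\in\Pi$, where $\sigma(\pi)$ is the $\sigma$-algebra generated by $\pi$; note $\mathbb{E}[X|\pi]\in\mathcal{L}$. $\sigma(L^1,\mathcal{L})$ is the coarsest topology on $L^1$ making $X\mapsto\mathbb{E}[XY]$ continuous for each $Y\in\mathcal{L}$. An ideal of $L^1$ is a linear subspace $\mathcal{J}$ such that $X\in L^1$, $|X|\le|Y|$, $Y\in\mathcal{J}$ imply $X\in\mathcal{J}$. $\mathcal{I}(\mathcal{X})$ is the smallest ideal of $L^1$ including $\mathcal{X}$, i.e. the set of $X\in L^1$ with $|X|\le\sum_{i=1}^n\lambda_i|X_i|$ for some $n\in\mathbb{N}$, $X_i\in\mathcal{X}$, $\lambda_i\ge 0$. For a subset $\mathcal{X}\subset L^1$ containing $\mathcal{L}$, a functional $\rho:\mathcal{X}\to[-\infty,\infty]$ is: dilatation monotone if $\rho(\mathbb{E}[X|\pi])\le\rho(X)$ for all $X\in\mathcal{X}$, $\pi\in\Pi$; law invariant if $\rho(X)=\rho(Y)$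 whenever $X,Y\in\mathcal{X}$ have the same distribution under $\mathbb{P}$; convex (resp. quasiconvex) if $\rho(\lambda X+(1-\lambda)Y)\le\lambda\rho(X)+(1-\lambda)\rho(Y)$ (resp. $\le\max\{\rho(X),\rho(Y)\}$) for all $X,Y\in\mathcal{X}$, $\lambda\in(0,1)$ with $\lambda X+(1-\lambda)Y\in\mathcal{X}$; cash-additive if $\rho(X+s)=\rho(X)-s$ for all $X\in\mathcal{X}$, $s\in\mathbb{R}$ with $X+s\in\mathcal{X}$; monotone if $\rho(X)\le\rho(Y)$ for all $X,Y\in\mathcal{X}$ with $X\ge Y$. $\rho$ has the Fatou property if for any sequence $(X_n)$ in $\mathcal{X}$ and $X\in\mathcal{X}$, $X_n\to X$ a.s. and $\sup_n|X_n|\in\mathcal{I}(\mathcal{X})$ imply $\rho(X)\le\liminf_n\rho(X_n)$. For a topology $\tau$ on $\mathcal{X}$, $\rho$ is $\tau$ lower semicontinuous if $\{X\in\mathcal{X}:\rho(X)\le\lambda\}$ is $\tau$-closed for each $\lambda\in\mathbb{R}$. *)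

theory Defs
  imports "HOL-Probability.Probability"
begin

text \<open>
  Random variables are represented by measurable functions rather than by classes modulo a.s.
  equality; equalities, inequalities and limits of random variables are stated with \<open>AE\<close>.
  Nothing is lost by this: \<open>Linf_space M\<close> contains every null function, so a set that includes it
  and is closed under addition is closed under a.s. equality, and a law invariant functional is
  constant on a.s. equality classes of its domain. A functional on a set \<open>D\<close> of random variables
  is a function into \<open>ereal\<close> of which only the values on \<open>D\<close> matter.
\<close>

definition nonatomic :: "'a measure \<Rightarrow> bool" where
  "nonatomic M \<longleftrightarrow>
     (\<forall>A\<in>sets M. measure M A > 0 \<longrightarrow>
        (\<exists>B\<in>sets M. B \<subseteq> A \<and> 0 < measure M B \<and> measure M B < measure M A))"

definition L1_space :: "'a measure \<Rightarrow> ('a \<Rightarrow> real) set" where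
  "L1_space M = {X. integrable M X}"

definition Linf_space :: "'a measure \<Rightarrow> ('a \<Rightarrow> real) set" where
  "Linf_space M = {X \<in> borel_measurable M. \<exists>c. AE \<omega> in M. \<bar>X \<omega>\<bar> \<le> c}"

definition finite_partitions :: "'a measure \<Rightarrow> 'a set set set" where
  "finite_partitions M =
     {\<pi>. finite \<pi> \<and> partition_on (space M) \<pi> \<and> (\<forall>A\<in>\<pi>. A \<in> sets M \<and> measure M A \<noteq> 0)}"

text \<open>
  As every member of \<open>\<pi>\<close> has nonzero probability, two versions of this conditional
  expectation that are measurable with respect to the sigma-algebra generated by \<open>\<pi>\<close> coincide
  everywhere on the space, not only almost surely.
\<close>

definition partition_cond_exp :: "'a measure \<Rightarrow> 'a set set \<Rightarrow> ('a \<Rightarrow> real) \<Rightarrow> 'a \<Rightarrow> real" where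
  "partition_cond_exp M \<pi> X = real_cond_exp M (sigma (space M) \<pi>) X"

text \<open>
  The coarsest topology on \<open>L1_space M\<close> making \<open>X \<mapsto> E[X Y]\<close> continuous for each simple \<open>Y\<close>.
  It does not distinguish a.s. equal functions, so its closed sets are exactly the preimages of
  the closed sets of the corresponding topology on the a.s. equality classes.
\<close>

definition weak_L1_topology :: "'a measure \<Rightarrow> ('a \<Rightarrow> real) topology" where
  "weak_L1_topology M = topology_generated_by
     {{X \<in> L1_space M. (\<integral>\<omega>. X \<omega> * Y \<omega> \<partial>M) \<in> U} | Y U. simple_function M Y \<and> open U}"

definition L1_ideal :: "'a measure \<Rightarrow> ('a \<Rightarrow> real) set \<Rightarrow> bool" where
  "L1_ideal M J \<longleftrightarrow>
     J \<subseteq> L1_space M \<and>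
     (\<lambda>\<omega>. 0) \<in> J \<and>
     (\<forall>X\<in>J. \<forall>Y\<in>J. (\<lambda>\<omega>. X \<omega> + Y \<omega>) \<in> J) \<and>
     (\<forall>X\<in>J. \<forall>c. (\<lambda>\<omega>. c * X \<omega>) \<in> J) \<and>
     (\<forall>X\<in>L1_space M. \<forall>Y\<in>J. (AE \<omega> in M. \<bar>X \<omega>\<bar> \<le> \<bar>Y \<omega>\<bar>) \<longrightarrow> X \<in> J)"

definition generated_ideal :: "'a measure \<Rightarrow> ('a \<Rightarrow> real) set \<Rightarrow> ('a \<Rightarrow> real) set" where
  "generated_ideal M D = \<Inter>{J. L1_ideal M J \<and> D \<subseteq> J}"

definition convex_rv_set :: "('a \<Rightarrow> real) set \<Rightarrow> bool" where
  "convex_rv_set D \<longleftrightarrow>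
     (\<forall>X\<in>D. \<forall>Y\<in>D. \<forall>l. 0 \<le> l \<and> l \<le> 1 \<longrightarrow> (\<lambda>\<omega>. l * X \<omega> + (1 - l) * Y \<omega>) \<in> D)"

definition dilatation_monotone ::
    "'a measure \<Rightarrow> ('a \<Rightarrow> real) set \<Rightarrow> (('a \<Rightarrow> real) \<Rightarrow> ereal) \<Rightarrow> bool" where
  "dilatation_monotone M D \<rho> \<longleftrightarrow>
     (\<forall>X\<in>D. \<forall>\<pi>\<in>finite_partitions M. \<rho> (partition_cond_exp M \<pi> X) \<le> \<rho> X)"

definition law_invariant ::
    "'a measure \<Rightarrow> ('a \<Rightarrow> real) set \<Rightarrow> (('a \<Rightarrow> real) \<Rightarrow> ereal) \<Rightarrow> bool" where
  "law_invariant M D \<rho> \<longleftrightarrow>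
     (\<forall>X\<in>D. \<forall>Y\<in>D. distr M borel X = distr M borel Y \<longrightarrow> \<rho> X = \<rho> Y)"

definition convex_functional :: "('a \<Rightarrow> real) set \<Rightarrow> (('a \<Rightarrow> real) \<Rightarrow> ereal) \<Rightarrow> bool" where
  "convex_functional D \<rho> \<longleftrightarrow>
     (\<forall>X\<in>D. \<forall>Y\<in>D. \<forall>l::real. 0 < l \<and> l < 1 \<and> (\<lambda>\<omega>. l * X \<omega> + (1 - l) * Y \<omega>) \<in> D \<longrightarrow>
        \<rho> (\<lambda>\<omega>. l * X \<omega> + (1 - l) * Y \<omega>) \<le> ereal l * \<rho> X + ereal (1 - l) * \<rho> Y)"

definition quasiconvex_functional :: "('a \<Rightarrow> real) set \<Rightarrow> (('a \<Rightarrow> real) \<Rightarrow> ereal) \<Rightarrow> bool" where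
  "quasiconvex_functional D \<rho> \<longleftrightarrow>
     (\<forall>X\<in>D. \<forall>Y\<in>D. \<forall>l::real. 0 < l \<and> l < 1 \<and> (\<lambda>\<omega>. l * X \<omega> + (1 - l) * Y \<omega>) \<in> D \<longrightarrow>
        \<rho> (\<lambda>\<omega>. l * X \<omega> + (1 - l) * Y \<omega>) \<le> max (\<rho> X) (\<rho> Y))"

definition cash_additive :: "('a \<Rightarrow> real) set \<Rightarrow> (('a \<Rightarrow> real) \<Rightarrow> ereal) \<Rightarrow> bool" where
  "cash_additive D \<rho> \<longleftrightarrow>
     (\<forall>X\<in>D. \<forall>s. (\<lambda>\<omega>. X \<omega> + s) \<in> D \<longrightarrow> \<rho> (\<lambda>\<omega>. X \<omega> + s) = \<rho> X - ereal s)"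

definition monotone_functional ::
    "'a measure \<Rightarrow> ('a \<Rightarrow> real) set \<Rightarrow> (('a \<Rightarrow> real) \<Rightarrow> ereal) \<Rightarrow> bool" where
  "monotone_functional M D \<rho> \<longleftrightarrow>
     (\<forall>X\<in>D. \<forall>Y\<in>D. (AE \<omega> in M. X \<omega> \<ge> Y \<omega>) \<longrightarrow> \<rho> X \<le> \<rho> Y)"

text \<open>
  The supremum of the \<open>\<bar>X n\<bar>\<close> is taken in \<open>ereal\<close>, because the supremum of an unbounded set of
  reals is a meaningless value; that it belongs to the ideal means that some member of the ideal
  is a version of it.
\<close>

definition fatou_property ::
    "'a measure \<Rightarrow> ('a \<Rightarrow> real) set \<Rightarrow> (('a \<Rightarrow> real) \<Rightarrow> ereal) \<Rightarrow> bool" where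
  "fatou_property M D \<rho> \<longleftrightarrow>
     (\<forall>X :: nat \<Rightarrow> 'a \<Rightarrow> real. \<forall>Y\<in>D.
        (\<forall>n. X n \<in> D) \<longrightarrow>
        (AE \<omega> in M. (\<lambda>n. X n \<omega>) \<longlonglongrightarrow> Y \<omega>) \<longrightarrow>
        (\<exists>S\<in>generated_ideal M D. AE \<omega> in M. (SUP n. ereal \<bar>X n \<omega>\<bar>) = ereal (S \<omega>)) \<longrightarrow>
        \<rho> Y \<le> liminf (\<lambda>n. \<rho> (X n)))"

definition lower_semicontinuous ::
    "('a \<Rightarrow> real) topology \<Rightarrow> ('a \<Rightarrow> real) set \<Rightarrow> (('a \<Rightarrow> real) \<Rightarrow> ereal) \<Rightarrow> bool" where
  "lower_semicontinuous T D \<rho> \<longleftrightarrow> (\<forall>l::real. closedin T {X \<in> D. \<rho> X \<le> ereal l})"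

definition dilatation_extension ::
    "'a measure \<Rightarrow> (('a \<Rightarrow> real) \<Rightarrow> ereal) \<Rightarrow> ('a \<Rightarrow> real) \<Rightarrow> ereal" where
  "dilatation_extension M \<rho> X = (SUP \<pi>\<in>finite_partitions M. \<rho> (partition_cond_exp M \<pi> X))"

end

(*
  Two quantile rearrangements of a bounded X, by a uniform U and by 1 - U, lie on opposite sides of
  the median, so their average has half the oscillation of X; by quasiconvexity and law invariance
  it does not increase rho. Iterating this on a set B and passing to the limit with the Fatou
  property replaces X on B by its mean. Rearranging only where X is bounded keeps X unchanged
  elsewhere, which is why no rearrangement invariance of the domain is needed. Applied to the cells
  of a partition this gives dilatation monotonicity of rho on its domain; conversely X is a
  dominated limit of conditional expectations, so the supremum over partitions recovers rho X.

  For a fixed partition, rho (E[X|pi]) depends only on the finitely many means of X over the cells,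
  and lower semicontinuously so by the Fatou property; this gives weak lower semicontinuity. Law
  invariance follows from it by approximating X in L1 by E[X|pi] with pi generated by X.
*)

theory Submission
  imports Defs
begin

section \<open>Uniform random variables on nonatomic spaces\<close>

text \<open>Quasiconvexity bounds the value at a midpoint only by the larger of the two end values,
  so flattening has to average variables on which \<open>\<rho>\<close> agrees, that is, copies with
  the same law. Such copies also share the integral. This identifies the constant towards which the
  values on a set shrink: halving controls the length of their range, not its location. The obstacle
  throughout is domination. The Fatou property speaks only of sequences whose supremum lies in the
  ideal generated by the domain, in practice sequences bounded by \<open>|S| + c\<close> with
  \<open>S\<close> in the domain. Unbounded variables are therefore flattened on growing sets where
  they are bounded, and partitions that recover \<open>X\<close> need a controlled mean over the
  tail. For \<open>X\<close> outside the domain no such bound is at hand; there the Fatou property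
  is applied only to means over one fixed finite partition, which are bounded. An arbitrary
  partition chosen for \<open>X\<close> has no counterpart for another variable of the same law, so
  law invariance has to pass through partitions that are defined by the values alone.\<close>

lemma (in prob_space) nonatomic_small_subset:
  assumes "nonatomic M" "A \<in> sets M" "prob A > 0" "e > 0"
  obtains B where "B \<in> sets M" "B \<subseteq> A" "0 < prob B" "prob B < e"
proof -
  \<comment> \<open>Nonatomicity splits \<open>B\<close> into \<open>C\<close> and
    \<open>B - C\<close>, both of positive mass, and one of them has at most half the mass of
    \<open>B\<close>.\<close>
  have halve: "\<exists>C\<in>sets M. C \<subseteq> B \<and> 0 < prob C \<and> prob C \<le> prob B / 2"
    if B: "B \<in> sets M" "prob B > 0" for B
  proof -
    obtain C where C: "C \<in> sets M" "C \<subseteq> B" "0 < prob C" "prob C < prob B"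
      using assms(1) B unfolding nonatomic_def by blast
    have diff: "prob (B - C) = prob B - prob C"
      using B C by (simp add: finite_measure_Diff)
    show ?thesis
    proof (cases "prob C \<le> prob B / 2")
      case True
      then show ?thesis using C by blast
    next
      case False
      then show ?thesis using C B diff by (intro bexI[of _ "B - C"]) auto
    qed
  qed
  have "\<exists>B\<in>sets M. B \<subseteq> A \<and> 0 < prob B \<and> prob B \<le> prob A / 2 ^ n" for n
  proof (induction n)
    case 0
    then show ?case using assms by auto
  next
    case (Suc n)
    then obtain B where B: "B \<in> sets M" "B \<subseteq> A" "0 < prob B" "prob B \<le> prob A / 2 ^ n"
      by blast
    obtain C where "C \<in> sets M" "C \<subseteq> B" "0 < prob C" "prob C \<le> prob B / 2"
      using halve B by blast
    then show ?case using B by (intro bexI[of _ C]) auto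
  qed
  moreover obtain n :: nat where n: "1 / e < 2 ^ n"
    using real_arch_pow[of 2 "1 / e"] by auto
  have "prob A / 2 ^ n \<le> 1 / 2 ^ n" by (intro divide_right_mono) auto
  moreover have "1 / 2 ^ n < e" using n assms(4) by (simp add: field_simps)
  ultimately show ?thesis using that by (meson order_le_less_trans order_trans)
qed

text \<open>
  Sierpinski's theorem. The subset is exhausted greedily: each step gains at least half of the
  mass that can still be gained, so what remains in the limit contains no set of positive mass
  fitting below \<open>t\<close>.
\<close>

lemma (in prob_space) nonatomic_intermediate:
  assumes "nonatomic M" "A \<in> sets M" "0 \<le> t" "t \<le> prob A"
  obtains B where "B \<in> sets M" "B \<subseteq> A" "prob B = t"
proof -
  define P where "P B \<longleftrightarrow> B \<in> sets M \<and> B \<subseteq> A \<and> prob B \<le> t" for B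
  define Q where "Q B C \<longleftrightarrow> B \<subseteq> C \<and>
    (\<forall>D. P D \<longrightarrow> B \<subseteq> D \<longrightarrow> prob D - prob B \<le> 2 * (prob C - prob B))" for B C
  have "\<exists>C. P C \<and> Q B C" if B: "P B" for B
  proof -
    define s where "s = Sup (prob ` {D. P D \<and> B \<subseteq> D})"
    have bdd: "bdd_above (prob ` {D. P D \<and> B \<subseteq> D})"
      by (intro bdd_aboveI[of _ t]) (auto simp: P_def)
    have s: "prob D \<le> s" if "P D" "B \<subseteq> D" for D
      unfolding s_def using that by (intro cSup_upper bdd) auto
    show ?thesis
    proof (cases "s = prob B")
      case True
      then show ?thesis using B s by (intro exI[of _ B]) (auto simp: Q_def)
    next
      case False
      then have "(s + prob B) / 2 < s" using s[OF B] by auto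
      moreover have "prob ` {D. P D \<and> B \<subseteq> D} \<noteq> {}" using B by auto
      ultimately have "\<exists>y\<in>prob ` {D. P D \<and> B \<subseteq> D}. (s + prob B) / 2 < y"
        using less_cSup_iff[OF _ bdd] unfolding s_def by blast
      then obtain C where "P C" "B \<subseteq> C" "(s + prob B) / 2 < prob C" by auto
      then show ?thesis using s by (intro exI[of _ C]) (fastforce simp: Q_def)
    qed
  qed
  moreover have "P {}" using assms by (auto simp: P_def)
  ultimately obtain E where E: "\<And>n. P (E n)" "\<And>n. Q (E n) (E (Suc n))"
    using dependent_nat_choice[of "\<lambda>n. P" "\<lambda>n. Q"] by metis
  have [measurable]: "E n \<in> sets M" for n using E(1) by (auto simp: P_def)
  have inc: "incseq E" using E(2) by (intro incseq_SucI) (auto simp: Q_def)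
  define F where "F = (\<Union>n. E n)"
  have F[measurable]: "F \<in> sets M" unfolding F_def by auto
  have FA: "F \<subseteq> A" using E(1) by (auto simp: F_def P_def)
  have lim: "(\<lambda>n. prob (E n)) \<longlonglongrightarrow> prob F"
    unfolding F_def by (intro finite_Lim_measure_incseq inc) auto
  have "prob F \<le> t"
    using LIMSEQ_le_const2[OF lim] E(1) by (auto simp: P_def)
  moreover have "\<not> prob F < t"
  proof
    assume less: "prob F < t"
    have "prob (A - F) = prob A - prob F" using FA assms by (simp add: finite_measure_Diff)
    then have "prob (A - F) > 0" using less assms by simp
    then obtain G where G: "G \<in> sets M" "G \<subseteq> A - F" "0 < prob G" "prob G < t - prob F"
      using nonatomic_small_subset[OF assms(1), of "A - F" "t - prob F"] less assms(2) by auto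
    \<comment> \<open>\<open>G\<close> could have been added at every stage, so every step gained at
      least half of \<open>prob G\<close>; but the gains tend to zero because the masses
      converge.\<close>
    have "prob G \<le> 2 * (prob (E (Suc n)) - prob (E n))" for n
    proof -
      have "E n \<inter> G = {}" using G F_def by auto
      then have U: "prob (E n \<union> G) = prob (E n) + prob G"
        using G by (intro finite_measure_Union) auto
      have "prob (E n) \<le> prob F" by (intro finite_measure_mono) (auto simp: F_def)
      then have "P (E n \<union> G)" using G U FA E(1)[of n] by (auto simp: P_def)
      then show ?thesis using E(2)[of n] U by (force simp: Q_def)
    qed
    moreover have "(\<lambda>n. 2 * (prob (E (Suc n)) - prob (E n))) \<longlonglongrightarrow> 2 * (prob F - prob F)"
      by (intro tendsto_intros lim LIMSEQ_Suc)
    ultimately have "prob G \<le> 0" by (intro LIMSEQ_le_const) auto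
    then show False using G by simp
  qed
  ultimately have "prob F = t" by simp
  then show ?thesis using that F FA by blast
qed

lemma (in prob_space) nonatomic_between:
  assumes "nonatomic M" "B \<in> sets M" "D \<in> sets M" "B \<subseteq> D" "prob B \<le> t" "t \<le> prob D"
  obtains C where "C \<in> sets M" "B \<subseteq> C" "C \<subseteq> D" "prob C = t"
proof -
  have "prob (D - B) = prob D - prob B" using assms by (simp add: finite_measure_Diff)
  then obtain C where C: "C \<in> sets M" "C \<subseteq> D - B" "prob C = t - prob B"
    using nonatomic_intermediate[OF assms(1), of "D - B" "t - prob B"] assms by auto
  have "prob (B \<union> C) = prob B + prob C" using C assms by (intro finite_measure_Union) auto
  then show ?thesis using that[of "B \<union> C"] C assms by auto
qed

text \<open>These sets are to become, up to boundaries, the sublevel sets at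
  \<open>k / 2 ^ n\<close> of a uniform variable. Each level keeps the previous one at even indices
  and inserts intermediate sets at odd ones. Indices beyond \<open>2 ^ n\<close> are allowed, which
  is why the mass is capped by \<open>min 1\<close>.\<close>

primrec dyadic_chain :: "'a measure \<Rightarrow> nat \<Rightarrow> nat \<Rightarrow> 'a set" where
  "dyadic_chain M 0 k = (if k = 0 then {} else space M)"
| "dyadic_chain M (Suc n) k =
    (if even k then dyadic_chain M n (k div 2)
     else (SOME C. C \<in> sets M \<and> dyadic_chain M n (k div 2) \<subseteq> C \<and>
        C \<subseteq> dyadic_chain M n (Suc (k div 2)) \<and> measure M C = min 1 (real k / 2 ^ Suc n)))"

text \<open>One induction carries all three claims: the choice at an odd index needs nesting and
  masses of its two neighbours one level below, and the nesting on the new level is read off from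
  that choice.\<close>

lemma (in prob_space) dyadic_chain:
  assumes "nonatomic M"
  shows "dyadic_chain M n k \<in> sets M \<and> dyadic_chain M n k \<subseteq> dyadic_chain M n (Suc k) \<and>
     prob (dyadic_chain M n k) = min 1 (real k / 2 ^ n)"
proof (induction n arbitrary: k)
  case 0
  then show ?case by (auto simp: prob_space)
next
  case (Suc n)
  have odd: "dyadic_chain M (Suc n) k \<in> sets M \<and> dyadic_chain M n (k div 2) \<subseteq> dyadic_chain M (Suc n) k \<and>
        dyadic_chain M (Suc n) k \<subseteq> dyadic_chain M n (Suc (k div 2)) \<and>
        prob (dyadic_chain M (Suc n) k) = min 1 (real k / 2 ^ Suc n)" if "odd k" for k
  proof -
    have k: "real k = 2 * real (k div 2) + 1" using that
      by (metis odd_two_times_div_two_succ of_nat_Suc of_nat_mult of_nat_numeral add.commute Suc_eq_plus1)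
    have "min 1 (real (k div 2) / 2 ^ n) \<le> min 1 (real k / 2 ^ Suc n)"
      "min 1 (real k / 2 ^ Suc n) \<le> min 1 (real (Suc (k div 2)) / 2 ^ n)"
      by (intro min.mono order_refl; simp add: k field_simps)+
    then have "\<exists>C. C \<in> sets M \<and> dyadic_chain M n (k div 2) \<subseteq> C \<and>
        C \<subseteq> dyadic_chain M n (Suc (k div 2)) \<and> measure M C = min 1 (real k / 2 ^ Suc n)"
      using nonatomic_between[OF assms, of "dyadic_chain M n (k div 2)" "dyadic_chain M n (Suc (k div 2))"
            "min 1 (real k / 2 ^ Suc n)"] Suc[of "k div 2"] Suc[of "Suc (k div 2)"] by metis
    from someI_ex[OF this] show ?thesis using that by simp
  qed
  have even: "dyadic_chain M (Suc n) k = dyadic_chain M n (k div 2)" if "even k" for k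
    using that by simp
  show ?case
  proof (cases "even k")
    case True
    then obtain j where j: "k = 2 * j" by auto
    have "Suc (2 * j) div 2 = j" by simp
    then show ?thesis using odd[of "Suc k"] Suc[of j] even[OF True] by (auto simp: j)
  next
    case False
    then have "Suc k div 2 = Suc (k div 2)" by presburger
    then show ?thesis using odd[of k] even[of "Suc k"] False by simp
  qed
qed

lemma dyadic_chain_refine: "dyadic_chain M (m + n) (2 ^ m * k) = dyadic_chain M n k"
proof (induction m)
  case (Suc m)
  then show ?case by (simp add: mult.assoc)
qed simp

text \<open>Both sets are rewritten at the common level \<open>m + n\<close>, where inclusion is
  monotonicity in the index.\<close>

lemma (in prob_space) dyadic_chain_mono:
  assumes "nonatomic M" "real j / 2 ^ m \<le> real k / 2 ^ n"
  shows "dyadic_chain M m j \<subseteq> dyadic_chain M n k"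
proof -
  have "real (2 ^ n * j) \<le> real (2 ^ m * k)"
    using assms(2) by (simp add: field_simps)
  then have "2 ^ n * j \<le> 2 ^ m * k" by (simp only: of_nat_le_iff)
  moreover have "mono (dyadic_chain M (m + n))"
    using dyadic_chain[OF assms(1)] by (simp add: mono_iff_le_Suc)
  ultimately have "dyadic_chain M (m + n) (2 ^ n * j) \<subseteq> dyadic_chain M (m + n) (2 ^ m * k)"
    by (auto simp: mono_def)
  then show ?thesis
    using dyadic_chain_refine[of M n m j] dyadic_chain_refine[of M m n k] by (simp add: add.commute)
qed

lemma dyadic_between:
  fixes a b :: real
  assumes "0 \<le> a" "a < b"
  obtains k n :: nat where "a < real k / 2 ^ n" "real k / 2 ^ n < b"
proof -
  obtain n :: nat where n: "1 / (b - a) < 2 ^ n" using real_arch_pow[of 2 "1 / (b - a)"] by auto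
  then have n': "1 < 2 ^ n * (b - a)" using assms by (simp add: field_simps)
  \<comment> \<open>The least integer strictly above \<open>2 ^ n * a\<close>; it stays below
    \<open>2 ^ n * b\<close> because the gap is longer than 1.\<close>
  define k where "k = nat (\<lfloor>2 ^ n * a\<rfloor> + 1)"
  have "real k = of_int \<lfloor>2 ^ n * a\<rfloor> + 1" using assms by (simp add: k_def)
  then have "2 ^ n * a < real k" "real k \<le> 2 ^ n * a + 1" by linarith+
  then have "a < real k / 2 ^ n" "real k / 2 ^ n < b" using n' by (auto simp: field_simps)
  then show ?thesis using that by blast
qed

text \<open>\<open>U x\<close> is the infimum of the dyadic levels whose sets contain
  \<open>x\<close>. Membership gives \<open>U x \<le> k / 2 ^ n\<close>, and
  \<open>U x < k / 2 ^ n\<close> gives membership, so a sublevel set of \<open>U\<close> is squeezed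
  between chain sets of known mass at dyadic levels on either side of \<open>t\<close>.\<close>

lemma (in prob_space) nonatomic_uniform:
  assumes "nonatomic M"
  obtains U :: "'a \<Rightarrow> real" where "U \<in> borel_measurable M"
    "\<And>t. 0 \<le> t \<Longrightarrow> t \<le> 1 \<Longrightarrow> prob {x \<in> space M. U x \<le> t} = t"
proof -
  let ?c = "dyadic_chain M"
  note chain = dyadic_chain[OF assms]
  define S where "S x = {real k / 2 ^ n |k n. x \<in> ?c n k}" for x
  define U where "U x = Inf (S x)" for x
  have bdd: "bdd_below (S x)" for x by (intro bdd_belowI[of _ 0]) (auto simp: S_def)
  have ne: "S x \<noteq> {}" if "x \<in> space M" for x
  proof -
    have "x \<in> ?c 0 1" using that by simp
    then show ?thesis unfolding S_def by blast
  qed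
  have le: "U x \<le> real k / 2 ^ n" if "x \<in> ?c n k" for x n k
    unfolding U_def using that by (intro cInf_lower bdd) (auto simp: S_def)
  have less: "x \<in> ?c n k" if x: "x \<in> space M" and U: "U x < real k / 2 ^ n" for x n k
  proof -
    obtain y where "y \<in> S x" "y < real k / 2 ^ n"
      using U cInf_less_iff[OF ne[OF x] bdd] by (auto simp: U_def)
    then obtain j m where "x \<in> ?c m j" "real j / 2 ^ m < real k / 2 ^ n" by (auto simp: S_def)
    then show ?thesis using dyadic_chain_mono[OF assms, of j m k n] by auto
  qed
  have nonneg: "0 \<le> U x" if "x \<in> space M" for x
    unfolding U_def using ne[OF that] by (intro cInf_greatest) (auto simp: S_def)
  have sub: "?c n k \<subseteq> space M" for n k using chain[of n k] sets.sets_into_space by blast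
  \<comment> \<open>Strict sublevel sets are used for measurability since they are exactly countable
    unions of chain sets.\<close>
  have eq: "{x \<in> space M. U x < t} = (\<Union>p \<in> {p. real (fst p) / 2 ^ snd p < t}. ?c (snd p) (fst p))" for t
  proof (intro set_eqI iffI)
    fix x assume x: "x \<in> {x \<in> space M. U x < t}"
    then obtain k n where "U x < real k / 2 ^ n" "real k / 2 ^ n < t"
      using dyadic_between[of "U x" t] nonneg by auto
    then show "x \<in> (\<Union>p \<in> {p. real (fst p) / 2 ^ snd p < t}. ?c (snd p) (fst p))"
      using less x by force
  next
    fix x assume "x \<in> (\<Union>p \<in> {p. real (fst p) / 2 ^ snd p < t}. ?c (snd p) (fst p))"
    then obtain k n where "x \<in> ?c n k" "real k / 2 ^ n < t" by auto
    then show "x \<in> {x \<in> space M. U x < t}" using le sub by force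
  qed
  have meas: "U \<in> borel_measurable M"
  proof (rule borel_measurableI_less)
    fix t
    show "{x \<in> space M. U x < t} \<in> sets M"
      unfolding eq by (rule sets.countable_UN'') (use chain in blast)+
  qed
  have "prob {x \<in> space M. U x \<le> t} = t" if t: "0 \<le> t" "t \<le> 1" for t
  proof (rule antisym)
    show "prob {x \<in> space M. U x \<le> t} \<le> t"
    proof (rule ccontr)
      assume "\<not> ?thesis"
      then obtain k n where kn: "t < real k / 2 ^ n" "real k / 2 ^ n < prob {x \<in> space M. U x \<le> t}"
        using dyadic_between[of t "prob {x \<in> space M. U x \<le> t}"] t by auto
      have "{x \<in> space M. U x \<le> t} \<subseteq> ?c n k" using less kn(1) by fastforce
      then have "prob {x \<in> space M. U x \<le> t} \<le> prob (?c n k)"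
        using chain[of n k] by (intro finite_measure_mono) auto
      then show False using kn chain[of n k] by auto
    qed
    show "t \<le> prob {x \<in> space M. U x \<le> t}"
    proof (rule ccontr)
      assume "\<not> ?thesis"
      then have "prob {x \<in> space M. U x \<le> t} < t" by simp
      then obtain k n where kn: "real k / 2 ^ n < t" "prob {x \<in> space M. U x \<le> t} < real k / 2 ^ n"
        using dyadic_between[OF measure_nonneg] by blast
      have "?c n k \<subseteq> {x \<in> space M. U x \<le> t}" using le sub kn(1) by fastforce
      then have "prob (?c n k) \<le> prob {x \<in> space M. U x \<le> t}"
        using meas by (intro finite_measure_mono) auto
      then show False using kn chain[of n k] t by auto
    qed
  qed
  with meas that show ?thesis by blast
qed

section \<open>Antithetic rearrangements\<close>

text \<open>There is no atom at \<open>t\<close>: the masses \<open>s\<close> of the sublevel sets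
  at \<open>s < t\<close> already exhaust \<open>t\<close>.\<close>

lemma (in prob_space) uniform_less:
  assumes [measurable]: "U \<in> borel_measurable M"
    and U: "\<And>t. 0 \<le> t \<Longrightarrow> t \<le> 1 \<Longrightarrow> prob {x \<in> space M. U x \<le> t} = t"
    and t: "0 \<le> t" "t \<le> 1"
  shows "prob {x \<in> space M. U x < t} = t"
proof (rule antisym)
  have "prob {x \<in> space M. U x < t} \<le> prob {x \<in> space M. U x \<le> t}"
    by (intro finite_measure_mono) auto
  then show "prob {x \<in> space M. U x < t} \<le> t" using U t by simp
  show "t \<le> prob {x \<in> space M. U x < t}"
  proof (rule dense_le)
    fix s assume s: "s < t"
    show "s \<le> prob {x \<in> space M. U x < t}"
    proof (cases "0 \<le> s")
      case True
      have "prob {x \<in> space M. U x \<le> s} \<le> prob {x \<in> space M. U x < t}"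
        using s by (intro finite_measure_mono) auto
      then show ?thesis using U[of s] True s t by simp
    qed (use measure_nonneg[of M "{x \<in> space M. U x < t}"] in linarith)
  qed
qed

text \<open>Inverse transform sampling: \<open>C\<close> is the distribution function and
  \<open>I\<close> its generalised inverse. The value 0 outside the open unit interval is a mere
  default, since \<open>V\<close> almost surely stays inside.\<close>

lemma (in cdf_distribution) distr_quantile:
  assumes "prob_space N" and V[measurable]: "V \<in> borel_measurable N"
    and U: "\<And>t. 0 \<le> t \<Longrightarrow> t \<le> 1 \<Longrightarrow> measure N {x \<in> space N. V x \<le> t} = t"
  defines "Q \<equiv> \<lambda>x. if 0 < V x \<and> V x < 1 then I (V x) else 0"
  shows "Q \<in> borel_measurable N" and "distr N borel Q = M" and "AE x in N. 0 < V x \<and> V x < 1"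
proof -
  interpret N: prob_space N by fact
  have "(\<lambda>u. if 0 < u \<and> u < 1 then I u else 0) \<in> borel_measurable borel"
    using measurable_CI measurable_If_restrict_space_iff[where P="\<lambda>u. 0 < u \<and> u < (1::real)" and M = borel
        and f = I and g = "\<lambda>_. 0" and N = borel]
    by (auto simp: greaterThanLessThan_def greaterThan_def lessThan_def Int_def)
  from measurable_compose[OF V this] show meas[measurable]: "Q \<in> borel_measurable N"
    by (simp add: Q_def)
  have "AE x in N. \<not> V x \<le> 0"
    using U[of 0] by (subst AE_iff_measurable[OF _ refl]) (auto simp: N.emeasure_eq_measure)
  moreover have "AE x in N. V x < 1"
    using N.uniform_less[OF V U, of 1] by (subst N.prob_Collect_eq_1[symmetric]) auto
  ultimately show AE: "AE x in N. 0 < V x \<and> V x < 1" by eventually_elim auto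
  show "distr N borel Q = M"
  proof (rule cdf_unique)
    show "real_distribution (distr N borel Q)" using meas by (rule N.real_distribution_distr)
    show "cdf (distr N borel Q) = cdf M"
    proof
      fix y
      have "cdf (distr N borel Q) y = measure N {x \<in> space N. Q x \<le> y}"
        by (simp add: cdf_def measure_distr vimage_def Int_def conj_commute)
      \<comment> \<open>The quantile function is adjoint to the distribution function: for
        \<open>u\<close> strictly between 0 and 1, \<open>I u \<le> y\<close> iff
        \<open>u \<le> C y\<close>.\<close>
      also have "\<dots> = measure N {x \<in> space N. V x \<le> C y}"
      proof (rule N.finite_measure_eq_AE)
        show "AE x in N. x \<in> {x \<in> space N. Q x \<le> y} \<longleftrightarrow> x \<in> {x \<in> space N. V x \<le> C y}"
          using AE
        proof eventually_elim
          case (elim x)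
          then show ?case using pseudoinverse[of "V x" y] by (auto simp: Q_def)
        qed
      qed auto
      also have "\<dots> = C y" using cdf_nonneg cdf_bounded_prob by (intro U) auto
      finally show "cdf (distr N borel Q) y = cdf M y" .
    qed
  qed unfold_locales
qed

text \<open>
  For the quantile function \<open>q\<close> of \<open>X\<close> and a uniform \<open>U\<close>, both \<open>q U\<close> and \<open>q (1 - U)\<close> have the
  law of \<open>X\<close>, and at every point they lie on opposite sides of the median \<open>m = q (1/2)\<close>. Hence
  averaging the two halves the oscillation.
\<close>

lemma (in prob_space) antithetic_rearrangement:
  assumes "nonatomic M" and X[measurable]: "X \<in> borel_measurable M"
    and ab: "AE x in M. a \<le> X x \<and> X x \<le> (b::real)"
  obtains Q1 Q2 m where "Q1 \<in> borel_measurable M" "Q2 \<in> borel_measurable M"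
    "distr M borel Q1 = distr M borel X" "distr M borel Q2 = distr M borel X"
    "AE x in M. a \<le> Q1 x \<and> Q1 x \<le> b" "AE x in M. a \<le> Q2 x \<and> Q2 x \<le> b"
    "AE x in M. (a + m) / 2 \<le> (Q1 x + Q2 x) / 2 \<and> (Q1 x + Q2 x) / 2 \<le> (m + b) / 2"
proof -
  obtain U where U[measurable]: "U \<in> borel_measurable M"
    and unif: "\<And>t. 0 \<le> t \<Longrightarrow> t \<le> 1 \<Longrightarrow> prob {x \<in> space M. U x \<le> t} = t"
    using nonatomic_uniform[OF assms(1)] by blast
  have unif': "prob {x \<in> space M. 1 - U x \<le> t} = t" if "0 \<le> t" "t \<le> 1" for t
  proof -
    \<comment> \<open>Reflection turns a sublevel set into the complement of a strict one, hence the
      appeal to \<open>uniform_less\<close>.\<close>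
    have "{x \<in> space M. 1 - U x \<le> t} = space M - {x \<in> space M. U x < 1 - t}" by auto
    then show ?thesis using uniform_less[OF U unif, of "1 - t"] that by (simp add: prob_compl)
  qed
  interpret nu: cdf_distribution "distr M borel X"
    using X by (simp add: cdf_distribution_def)
  define Q where "Q V x = (if 0 < V x \<and> V x < 1 then nu.I (V x) else 0)" for V :: "'a \<Rightarrow> real" and x
  have Q_eq: "Q V = (\<lambda>x. if 0 < V x \<and> V x < 1 then nu.I (V x) else 0)" for V
    by (simp add: Q_def fun_eq_iff)
  note Q = nu.distr_quantile[OF prob_space_axioms, folded Q_eq]
  define Q1 where "Q1 = Q U"
  define Q2 where "Q2 = Q (\<lambda>x. 1 - U x)"
  have Q1: "Q1 \<in> borel_measurable M" "distr M borel Q1 = distr M borel X" "AE x in M. 0 < U x \<and> U x < 1"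
    using Q[OF U unif] by (simp_all add: Q1_def)
  have Q2: "Q2 \<in> borel_measurable M" "distr M borel Q2 = distr M borel X"
    using Q[OF _ unif'] by (simp_all add: Q2_def)
  \<comment> \<open>Almost sure bounds depend on the law alone, so every copy inherits those of
    \<open>X\<close>.\<close>
  have same: "AE x in M. a \<le> Z x \<and> Z x \<le> b"
    if [measurable]: "Z \<in> borel_measurable M" and Z: "distr M borel Z = distr M borel X" for Z
  proof -
    have "AE y in distr M borel X. a \<le> y \<and> y \<le> b"
      using ab by (subst AE_distr_iff) auto
    then show ?thesis unfolding Z[symmetric] by (subst (asm) AE_distr_iff) auto
  qed
  have mono: "nu.I u \<le> nu.I v" if "0 < u" "u \<le> v" "v < 1" for u v
    using mono_onD[OF nu.mono_I, of u v] that by auto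
  have "AE x in M. (a + nu.I (1/2)) / 2 \<le> (Q1 x + Q2 x) / 2 \<and> (Q1 x + Q2 x) / 2 \<le> (nu.I (1/2) + b) / 2"
    using Q1(3) same[OF Q1(1,2)] same[OF Q2(1,2)]
  proof eventually_elim
    case (elim x)
    then have "Q1 x = nu.I (U x)" "Q2 x = nu.I (1 - U x)" by (auto simp: Q1_def Q2_def Q_def)
    then show ?case
      using elim mono[of "U x" "1/2"] mono[of "1/2" "U x"] mono[of "1 - U x" "1/2"] mono[of "1/2" "1 - U x"]
      by (cases "U x \<le> 1/2") auto
  qed
  then show ?thesis using that Q1 Q2 same by blast
qed

text \<open>Only the part of \<open>A\<close> inside \<open>B\<close> carries conditional mass, and
  splitting that part splits \<open>A\<close> after rescaling by \<open>prob B\<close>. This makes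
  the rearrangement available under the conditional probability given \<open>B\<close>.\<close>

lemma (in prob_space) nonatomic_uniform_measure:
  assumes "nonatomic M" and [measurable]: "B \<in> sets M" and "prob B > 0"
  shows "nonatomic (uniform_measure M B)"
  unfolding nonatomic_def
proof safe
  fix A assume "A \<in> sets (uniform_measure M B)" and pos: "0 < measure (uniform_measure M B) A"
  then have A[measurable]: "A \<in> sets M" by simp
  have meas: "measure (uniform_measure M B) C = prob (B \<inter> C) / prob B" if "C \<in> sets M" for C
    using that assms by (intro measure_uniform_measure) (auto simp: emeasure_eq_measure)
  have "prob (B \<inter> A) > 0" using pos assms by (simp add: meas zero_less_divide_iff)
  then obtain C where C: "C \<in> sets M" "C \<subseteq> B \<inter> A" "0 < prob C" "prob C < prob (B \<inter> A)"
    using assms(1) unfolding nonatomic_def by (meson A assms(2) sets.Int)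
  moreover have "B \<inter> C = C" using C by auto
  ultimately show "\<exists>C\<in>sets (uniform_measure M B). C \<subseteq> A \<and> 0 < measure (uniform_measure M B) C \<and>
      measure (uniform_measure M B) C < measure (uniform_measure M B) A"
    using assms by (intro bexI[of _ C]) (auto simp: meas divide_strict_right_mono)
qed

text \<open>The mass of a preimage is the sum of its parts inside and outside \<open>B\<close>: the
  former agree by equality of the conditional laws, the latter because the function is unchanged
  there.\<close>

lemma (in prob_space) distr_modify_on:
  assumes [measurable]: "B \<in> sets M" "X \<in> borel_measurable M" "Q \<in> borel_measurable M"
    and B: "prob B > 0"
    and Q: "distr (uniform_measure M B) borel Q = distr (uniform_measure M B) borel X"
  shows "distr M borel (\<lambda>x. if x \<in> B then Q x else X x) = distr M borel (X :: 'a \<Rightarrow> real)"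
proof (rule measure_eqI)
  fix S assume "S \<in> sets (distr M borel (\<lambda>x. if x \<in> B then Q x else X x))"
  then have [measurable]: "S \<in> sets borel" by simp
  have dist: "measure (distr (uniform_measure M B) borel Z) S = prob (B \<inter> (Z -` S \<inter> space M)) / prob B"
    if [measurable]: "Z \<in> borel_measurable M" for Z :: "'a \<Rightarrow> real"
    using B by (subst measure_distr) (auto intro!: measure_uniform_measure simp: emeasure_eq_measure)
  have eq: "prob (B \<inter> (Q -` S \<inter> space M)) = prob (B \<inter> (X -` S \<inter> space M))"
    using dist[of Q] dist[of X] Q B by simp
  have split: "prob E = prob (B \<inter> E) + prob (E - B)" if [measurable]: "E \<in> sets M" for E
    by (subst finite_measure_Union[symmetric]) (auto intro!: arg_cong[where f = prob])
  define Y where "Y = (\<lambda>x. if x \<in> B then Q x else X x)"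
  have [measurable]: "Y \<in> borel_measurable M" unfolding Y_def by measurable
  have "B \<inter> (Y -` S \<inter> space M) = B \<inter> (Q -` S \<inter> space M)"
    "(Y -` S \<inter> space M) - B = (X -` S \<inter> space M) - B" by (auto simp: Y_def)
  then have "prob (Y -` S \<inter> space M) = prob (X -` S \<inter> space M)"
    using split[of "Y -` S \<inter> space M"] split[of "X -` S \<inter> space M"] eq by simp
  then show "emeasure (distr M borel (\<lambda>x. if x \<in> B then Q x else X x)) S = emeasure (distr M borel X) S"
    unfolding Y_def[symmetric] by (simp add: emeasure_distr emeasure_eq_measure)
qed simp

lemma (in prob_space) antithetic_rearrangement_on:
  assumes "nonatomic M" and [measurable]: "B \<in> sets M" "X \<in> borel_measurable M"
    and B: "prob B > 0" and ab: "AE x in M. x \<in> B \<longrightarrow> a \<le> X x \<and> X x \<le> (b::real)"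
  obtains Y1 Y2 m where "Y1 \<in> borel_measurable M" "Y2 \<in> borel_measurable M"
    "distr M borel Y1 = distr M borel X" "distr M borel Y2 = distr M borel X"
    "\<forall>x. x \<notin> B \<longrightarrow> Y1 x = X x" "\<forall>x. x \<notin> B \<longrightarrow> Y2 x = X x"
    "AE x in M. x \<in> B \<longrightarrow> a \<le> Y1 x \<and> Y1 x \<le> b" "AE x in M. x \<in> B \<longrightarrow> a \<le> Y2 x \<and> Y2 x \<le> b"
    "AE x in M. x \<in> B \<longrightarrow> (a + m) / 2 \<le> (Y1 x + Y2 x) / 2 \<and> (Y1 x + Y2 x) / 2 \<le> (m + b) / 2"
proof -
  let ?N = "uniform_measure M B"
  interpret N: prob_space ?N using B by (intro prob_space_uniform_measure) (auto simp: emeasure_eq_measure)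
  have AE: "(AE x in ?N. P x) \<longleftrightarrow> (AE x in M. x \<in> B \<longrightarrow> P x)" for P
    using B by (intro AE_uniform_measure) (auto simp: emeasure_eq_measure)
  have "X \<in> borel_measurable ?N" "AE x in ?N. a \<le> X x \<and> X x \<le> b"
    using ab unfolding AE by simp_all
  then obtain Q1 Q2 m where Q: "Q1 \<in> borel_measurable ?N" "Q2 \<in> borel_measurable ?N"
    "distr ?N borel Q1 = distr ?N borel X" "distr ?N borel Q2 = distr ?N borel X"
    "AE x in ?N. a \<le> Q1 x \<and> Q1 x \<le> b" "AE x in ?N. a \<le> Q2 x \<and> Q2 x \<le> b"
    "AE x in ?N. (a + m) / 2 \<le> (Q1 x + Q2 x) / 2 \<and> (Q1 x + Q2 x) / 2 \<le> (m + b) / 2"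
    by (rule N.antithetic_rearrangement[OF nonatomic_uniform_measure[OF assms(1,2) B]])
  have [measurable]: "Q1 \<in> borel_measurable M" "Q2 \<in> borel_measurable M" using Q(1,2) by simp_all
  show ?thesis
  proof (rule that[of "\<lambda>x. if x \<in> B then Q1 x else X x" "\<lambda>x. if x \<in> B then Q2 x else X x" m])
    show "distr M borel (\<lambda>x. if x \<in> B then Q1 x else X x) = distr M borel X"
      by (rule distr_modify_on[OF _ _ _ B Q(3)]) measurable
    show "distr M borel (\<lambda>x. if x \<in> B then Q2 x else X x) = distr M borel X"
      by (rule distr_modify_on[OF _ _ _ B Q(4)]) measurable
    show "AE x in M. x \<in> B \<longrightarrow> a \<le> (if x \<in> B then Q1 x else X x) \<and> (if x \<in> B then Q1 x else X x) \<le> b"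
      using Q(5) unfolding AE by eventually_elim auto
    show "AE x in M. x \<in> B \<longrightarrow> a \<le> (if x \<in> B then Q2 x else X x) \<and> (if x \<in> B then Q2 x else X x) \<le> b"
      using Q(6) unfolding AE by eventually_elim auto
    show "AE x in M. x \<in> B \<longrightarrow>
        (a + m) / 2 \<le> ((if x \<in> B then Q1 x else X x) + (if x \<in> B then Q2 x else X x)) / 2 \<and>
        ((if x \<in> B then Q1 x else X x) + (if x \<in> B then Q2 x else X x)) / 2 \<le> (m + b) / 2"
      using Q(7) unfolding AE by eventually_elim auto
  qed auto
qed

section \<open>Averaging over a set\<close>

text \<open>On null sets division by zero makes this 0, a default that is harmless because it
  affects variables only on null sets.\<close>

definition set_mean :: "'a measure \<Rightarrow> 'a set \<Rightarrow> ('a \<Rightarrow> real) \<Rightarrow> real" where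
  "set_mean M A X = (\<integral>x. X x * indicator A x \<partial>M) / measure M A"

locale fatou_functional = prob_space M for M :: "'a measure" +
  fixes D :: "('a \<Rightarrow> real) set" and \<rho> :: "('a \<Rightarrow> real) \<Rightarrow> ereal"
  assumes nonatomic: "nonatomic M"
    and D_L1: "D \<subseteq> L1_space M"
    and D_convex: "convex_rv_set D"
    and D_add: "\<And>X Y. X \<in> D \<Longrightarrow> Y \<in> D \<Longrightarrow> (\<lambda>x. X x + Y x) \<in> D"
    and Linf_D: "Linf_space M \<subseteq> D"
    and D_indicator: "\<And>X A. X \<in> D \<Longrightarrow> A \<in> sets M \<Longrightarrow> (\<lambda>x. X x * indicator A x) \<in> D"
    and not_MInf: "\<And>X. X \<in> D \<Longrightarrow> \<rho> X \<noteq> -\<infinity>"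
    and quasiconvex: "quasiconvex_functional D \<rho>"
    and law_inv: "law_invariant M D \<rho>"
    and fatou: "fatou_property M D \<rho>"
begin

section \<open>Membership in the domain and a domination form of the Fatou property\<close>

lemma law_cong: "X \<in> D \<Longrightarrow> Y \<in> D \<Longrightarrow> distr M borel X = distr M borel Y \<Longrightarrow> \<rho> X = \<rho> Y"
  using law_inv unfolding law_invariant_def by blast

lemma integrable_D: "X \<in> D \<Longrightarrow> integrable M X"
  using D_L1 by (auto simp: L1_space_def)

lemma measurable_D: "X \<in> D \<Longrightarrow> X \<in> borel_measurable M"
  using integrable_D by auto

lemma bounded_in_D: "X \<in> borel_measurable M \<Longrightarrow> AE x in M. \<bar>X x\<bar> \<le> c \<Longrightarrow> X \<in> D"
  using Linf_D by (auto simp: Linf_space_def)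

text \<open>\<open>Z\<close> is almost surely the restriction of \<open>X\<close> to the complement
  of \<open>B\<close> plus a bounded remainder \<open>W\<close>, so restriction to sets, bounded
  variables and addition suffice.\<close>

lemma modify_bounded_in_D:
  assumes "X \<in> D" and [measurable]: "B \<in> sets M" "Z \<in> borel_measurable M"
    and "AE x in M. x \<in> B \<longrightarrow> \<bar>Z x\<bar> \<le> c" "AE x in M. x \<notin> B \<longrightarrow> Z x = X x"
  shows "Z \<in> D"
proof -
  note [measurable] = measurable_D[OF assms(1)]
  define W where "W = (\<lambda>x. Z x - X x * indicator (space M - B) x)"
  have "AE x in M. \<bar>W x\<bar> \<le> \<bar>c\<bar>"
    using assms(4,5) AE_space by eventually_elim (auto simp: W_def indicator_def)
  then have "W \<in> D" by (intro bounded_in_D) (auto simp: W_def)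
  from D_add[OF D_indicator[OF assms(1), of "space M - B"] this] show ?thesis
    by (simp add: W_def)
qed

text \<open>\<open>\<rho>\<close> acts on functions, not on classes, and law invariance is what
  makes it blind to null sets. Membership is the previous modification with \<open>B\<close>
  empty.\<close>

lemma cong_AE:
  assumes "X \<in> D" "Y \<in> borel_measurable M" "AE x in M. X x = Y x"
  shows "Y \<in> D" "\<rho> Y = \<rho> X"
proof -
  show Y: "Y \<in> D"
    using assms by (intro modify_bounded_in_D[of X "{}" Y 0]) auto
  have "distr M borel Y = distr M borel X"
    using assms measurable_D by (intro distr_cong_AE) auto
  then show "\<rho> Y = \<rho> X"
    using law_cong[OF Y assms(1)] by simp
qed

lemma half_le:
  assumes "X \<in> D" "Y \<in> D" "\<rho> X \<le> r" "\<rho> Y \<le> r"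
  shows "(\<lambda>x. (X x + Y x) / 2) \<in> D" "\<rho> (\<lambda>x. (X x + Y x) / 2) \<le> r"
proof -
  have eq: "(\<lambda>x. (X x + Y x) / 2) = (\<lambda>x. (1/2) * X x + (1 - 1/2) * Y x)"
    by (simp add: fun_eq_iff field_simps)
  have mem: "(\<lambda>x. (1/2) * X x + (1 - 1/2) * Y x) \<in> D"
    using D_convex[unfolded convex_rv_set_def, rule_format, OF assms(1,2), of "1/2"] by simp
  have "\<rho> (\<lambda>x. (1/2) * X x + (1 - 1/2) * Y x) \<le> max (\<rho> X) (\<rho> Y)"
    using quasiconvex[unfolded quasiconvex_functional_def, rule_format, OF assms(1,2), of "1/2"] mem by simp
  also have "\<dots> \<le> r" using assms by simp
  finally show "\<rho> (\<lambda>x. (X x + Y x) / 2) \<le> r" unfolding eq .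
  show "(\<lambda>x. (X x + Y x) / 2) \<in> D" using mem unfolding eq .
qed

text \<open>An ideal that includes the domain contains \<open>|S|\<close> and the constants, hence
  every measurable function below \<open>|S| + c\<close>, and the pointwise supremum of the
  \<open>|Z n|\<close> is one of these. This replaces the ideal condition by a bound for each
  \<open>n\<close>.\<close>

lemma fatou_dominated:
  assumes Z: "\<And>n. Z n \<in> D" and Y: "Y \<in> D" and S: "S \<in> D"
    and conv: "AE x in M. (\<lambda>n. Z n x) \<longlonglongrightarrow> Y x"
    and bound: "\<And>n. AE x in M. \<bar>Z n x\<bar> \<le> \<bar>S x\<bar> + c"
  shows "\<rho> Y \<le> liminf (\<lambda>n. \<rho> (Z n))"
proof -
  note [measurable] = measurable_D[OF Z] measurable_D[OF S]
  define G where "G x = real_of_ereal (SUP n. ereal \<bar>Z n x\<bar>)" for x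
  have [measurable]: "G \<in> borel_measurable M" unfolding G_def by measurable
  have "AE x in M. \<forall>n. \<bar>Z n x\<bar> \<le> \<bar>S x\<bar> + c" using bound by (simp add: AE_all_countable)
  then have G: "AE x in M. (SUP n. ereal \<bar>Z n x\<bar>) = ereal (G x) \<and> \<bar>G x\<bar> \<le> \<bar>S x\<bar> + c"
  proof eventually_elim
    case (elim x)
    have "(SUP n. ereal \<bar>Z n x\<bar>) \<le> ereal (\<bar>S x\<bar> + c)" using elim by (intro SUP_least) auto
    moreover have "0 \<le> (SUP n. ereal \<bar>Z n x\<bar>)" by (intro SUP_upper2[of 0]) auto
    ultimately show ?case
      unfolding G_def by (cases "SUP n. ereal \<bar>Z n x\<bar>") auto
  qed
  \<comment> \<open>The generated ideal is an intersection, so membership is tested in an arbitrary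
    ideal.\<close>
  have "G \<in> J" if J: "L1_ideal M J" "D \<subseteq> J" for J
  proof -
    have dom: "X \<in> J" if "X \<in> borel_measurable M" "W \<in> J" "AE x in M. \<bar>X x\<bar> \<le> \<bar>W x\<bar>" for X W
    proof -
      have "integrable M W" using that J by (auto simp: L1_ideal_def L1_space_def)
      then have "integrable M X"
        by (rule Bochner_Integration.integrable_bound) (use that in auto)
      then show ?thesis using J that by (auto simp: L1_ideal_def L1_space_def)
    qed
    have "(\<lambda>x. \<bar>S x\<bar>) \<in> J" by (rule dom[of _ S]) (use S J in auto)
    moreover have "(\<lambda>x. c) \<in> J" using J bounded_in_D[of "\<lambda>x. c" "\<bar>c\<bar>"] by auto
    ultimately have "(\<lambda>x. \<bar>S x\<bar> + c) \<in> J" using J by (auto simp: L1_ideal_def)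
    then show ?thesis by (rule dom[rotated]) (use G in auto)
  qed
  then have "G \<in> generated_ideal M D" by (auto simp: generated_ideal_def)
  moreover have "AE x in M. (SUP n. ereal \<bar>Z n x\<bar>) = ereal (G x)" using G by eventually_elim simp
  ultimately show ?thesis
    using fatou Y Z conv unfolding fatou_property_def by blast
qed

text \<open>Both rearranged copies have the law of \<open>X\<close>, hence its value under
  \<open>\<rho>\<close> and its integral, and \<open>Y\<close> is their midpoint. The new range has
  half the length whatever \<open>m\<close> is.\<close>

lemma halve_oscillation:
  assumes X: "X \<in> D" and B[measurable]: "B \<in> sets M" "prob B > 0"
    and ab: "AE x in M. x \<in> B \<longrightarrow> a \<le> X x \<and> X x \<le> b"
  obtains Y m where "Y \<in> D" "\<rho> Y \<le> \<rho> X" "\<forall>x. x \<notin> B \<longrightarrow> Y x = X x"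
    "integral\<^sup>L M Y = integral\<^sup>L M X"
    "AE x in M. x \<in> B \<longrightarrow> (a + m) / 2 \<le> Y x \<and> Y x \<le> (m + b) / 2"
proof -
  note [measurable] = measurable_D[OF X]
  obtain Y1 Y2 m where [measurable]: "Y1 \<in> borel_measurable M" "Y2 \<in> borel_measurable M"
    and law: "distr M borel Y1 = distr M borel X" "distr M borel Y2 = distr M borel X"
    and off: "\<forall>x. x \<notin> B \<longrightarrow> Y1 x = X x" "\<forall>x. x \<notin> B \<longrightarrow> Y2 x = X x"
    and bd: "AE x in M. x \<in> B \<longrightarrow> a \<le> Y1 x \<and> Y1 x \<le> b" "AE x in M. x \<in> B \<longrightarrow> a \<le> Y2 x \<and> Y2 x \<le> b"
    and half: "AE x in M. x \<in> B \<longrightarrow> (a + m) / 2 \<le> (Y1 x + Y2 x) / 2 \<and> (Y1 x + Y2 x) / 2 \<le> (m + b) / 2"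
    by (rule antithetic_rearrangement_on[OF nonatomic B(1) measurable_D[OF X] B(2) ab])
  have Y: "Y \<in> D \<and> \<rho> Y \<le> \<rho> X \<and> integral\<^sup>L M Y = integral\<^sup>L M X"
    if [measurable]: "Y \<in> borel_measurable M" and law: "distr M borel Y = distr M borel X"
      and off: "\<forall>x. x \<notin> B \<longrightarrow> Y x = X x" and bd: "AE x in M. x \<in> B \<longrightarrow> a \<le> Y x \<and> Y x \<le> b" for Y
  proof -
    have "AE x in M. x \<in> B \<longrightarrow> \<bar>Y x\<bar> \<le> \<bar>a\<bar> + \<bar>b\<bar>" using bd by eventually_elim auto
    then have "Y \<in> D" using off by (intro modify_bounded_in_D[OF X B(1)]) auto
    moreover have "\<rho> Y = \<rho> X"
      using law_cong[OF \<open>Y \<in> D\<close> X law] .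
    moreover have "integral\<^sup>L M Y = integral\<^sup>L (distr M borel Y) (\<lambda>y. y)" by (simp add: integral_distr)
    moreover have "integral\<^sup>L M X = integral\<^sup>L (distr M borel X) (\<lambda>y. y)" by (simp add: integral_distr)
    ultimately show ?thesis using law by simp
  qed
  note Y1 = Y[OF _ law(1) off(1) bd(1), simplified] and Y2 = Y[OF _ law(2) off(2) bd(2), simplified]
  show ?thesis
  proof (rule that[of "\<lambda>x. (Y1 x + Y2 x) / 2" m])
    show "(\<lambda>x. (Y1 x + Y2 x) / 2) \<in> D" "\<rho> (\<lambda>x. (Y1 x + Y2 x) / 2) \<le> \<rho> X"
      using half_le[of Y1 Y2] Y1 Y2 by auto
    show "(\<integral>x. (Y1 x + Y2 x) / 2 \<partial>M) = integral\<^sup>L M X"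
      using Y1 Y2 integrable_D[of Y1] integrable_D[of Y2] by simp
  qed (use half off in auto)
qed

text \<open>The endpoints drift with medians that are not computed, so only the length of the range
  is tracked, together with the integral that will locate it.\<close>

lemma iterate_halve_oscillation:
  assumes X: "X \<in> D" and B: "B \<in> sets M" "prob B > 0"
    and ab: "AE x in M. x \<in> B \<longrightarrow> a \<le> X x \<and> X x \<le> b"
  shows "\<exists>Y a' b'. Y \<in> D \<and> \<rho> Y \<le> \<rho> X \<and> (\<forall>x. x \<notin> B \<longrightarrow> Y x = X x) \<and>
    integral\<^sup>L M Y = integral\<^sup>L M X \<and> b' - a' = (b - a) / 2 ^ n \<and>
    (AE x in M. x \<in> B \<longrightarrow> a' \<le> Y x \<and> Y x \<le> b')"
proof (induction n)
  case 0
  then show ?case using X ab by (intro exI[of _ X] exI[of _ a] exI[of _ b]) auto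
next
  case (Suc n)
  then obtain Y a' b' where Y: "Y \<in> D" "\<rho> Y \<le> \<rho> X" "\<forall>x. x \<notin> B \<longrightarrow> Y x = X x"
    "integral\<^sup>L M Y = integral\<^sup>L M X" "b' - a' = (b - a) / 2 ^ n"
    "AE x in M. x \<in> B \<longrightarrow> a' \<le> Y x \<and> Y x \<le> b'" by blast
  obtain W m where W: "W \<in> D" "\<rho> W \<le> \<rho> Y" "\<forall>x. x \<notin> B \<longrightarrow> W x = Y x"
    "integral\<^sup>L M W = integral\<^sup>L M Y"
    "AE x in M. x \<in> B \<longrightarrow> (a' + m) / 2 \<le> W x \<and> W x \<le> (m + b') / 2"
    by (rule halve_oscillation[OF Y(1) B Y(6)])
  have "(m + b') / 2 - (a' + m) / 2 = (b' - a') / 2" by (simp add: field_simps)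
  then have "(m + b') / 2 - (a' + m) / 2 = (b - a) / 2 ^ Suc n" using Y(5) by simp
  then show ?case using Y W by (intro exI[of _ W] exI[of _ "(a' + m) / 2"] exI[of _ "(m + b') / 2"]) auto
qed

text \<open>\<open>Y\<close> has the integral of \<open>X\<close> and agrees with it off
  \<open>B\<close>, so their integrals over \<open>B\<close> agree too. Hence the mean of
  \<open>X\<close> over \<open>B\<close> lies in the same short interval as the values of
  \<open>Y\<close>.\<close>

lemma flatten:
  assumes X: "X \<in> D" and B[measurable]: "B \<in> sets M"
    and c: "AE x in M. x \<in> B \<longrightarrow> \<bar>X x\<bar> \<le> c" and "e > 0"
  shows "\<exists>Y\<in>D. \<rho> Y \<le> \<rho> X \<and> (\<forall>x. x \<notin> B \<longrightarrow> Y x = X x) \<and>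
    (AE x in M. x \<in> B \<longrightarrow> \<bar>Y x - set_mean M B X\<bar> \<le> e)"
proof (cases "prob B = 0")
  case True
  then have "AE x in M. x \<notin> B"
    by (subst AE_iff_measurable[OF B]) (auto simp: emeasure_eq_measure dest: sets.sets_into_space[OF B, THEN subsetD])
  then show ?thesis using X by (intro bexI[of _ X]) auto
next
  case False
  then have pos: "prob B > 0" by (simp add: zero_less_measure_iff)
  \<comment> \<open>The initial range has length \<open>2 * |c|\<close>; the absolute value is taken
    because \<open>c\<close> may be negative when \<open>B\<close> is null, and it costs nothing
    otherwise.\<close>
  obtain n :: nat where n: "2 * \<bar>c\<bar> / e < 2 ^ n" using real_arch_pow[of 2 "2 * \<bar>c\<bar> / e"] by auto
  have "AE x in M. x \<in> B \<longrightarrow> - \<bar>c\<bar> \<le> X x \<and> X x \<le> \<bar>c\<bar>" using c by eventually_elim auto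
  from iterate_halve_oscillation[OF X B pos this, of n] obtain Y a b where
    Y: "Y \<in> D" "\<rho> Y \<le> \<rho> X" "\<And>x. x \<notin> B \<Longrightarrow> Y x = X x"
    "integral\<^sup>L M Y = integral\<^sup>L M X" and ba: "b - a = (\<bar>c\<bar> - (- \<bar>c\<bar>)) / 2 ^ n"
    and ab: "AE x in M. x \<in> B \<longrightarrow> a \<le> Y x \<and> Y x \<le> b" by blast
  have "b - a \<le> e" using n \<open>e > 0\<close> unfolding ba by (simp add: field_simps)
  note [simp] = integrable_D[OF X] integrable_D[OF Y(1)]
  have intB: "integrable M (\<lambda>x. Z x * indicator B x)" if "integrable M Z" for Z :: "'a \<Rightarrow> real"
    using that by (rule integrable_real_mult_indicator[OF B])
  have "(\<integral>x. Y x - X x \<partial>M) = (\<integral>x. Y x * indicator B x - X x * indicator B x \<partial>M)"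
    using Y(3) by (intro Bochner_Integration.integral_cong) (auto simp: indicator_def)
  then have eq: "(\<integral>x. Y x * indicator B x \<partial>M) = (\<integral>x. X x * indicator B x \<partial>M)"
    using Y(4) by (simp add: intB)
  have "(\<integral>x. a * indicator B x \<partial>M) \<le> (\<integral>x. Y x * indicator B x \<partial>M)"
    using ab by (intro integral_mono_AE intB) (auto elim!: eventually_mono simp: indicator_def)
  moreover have "(\<integral>x. Y x * indicator B x \<partial>M) \<le> (\<integral>x. b * indicator B x \<partial>M)"
    using ab by (intro integral_mono_AE intB) (auto elim!: eventually_mono simp: indicator_def)
  ultimately have "a * prob B \<le> (\<integral>x. X x * indicator B x \<partial>M)" "(\<integral>x. X x * indicator B x \<partial>M) \<le> b * prob B"
    by (simp_all add: eq)
  then have "a \<le> set_mean M B X" "set_mean M B X \<le> b"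
    using pos by (simp_all add: set_mean_def field_simps)
  then have "AE x in M. x \<in> B \<longrightarrow> \<bar>Y x - set_mean M B X\<bar> \<le> e"
    using ab \<open>b - a \<le> e\<close> by (auto elim!: eventually_mono)
  then show ?thesis using Y by blast
qed

text \<open>\<open>X\<close> may be unbounded on \<open>A\<close>, so it is flattened on the parts
  \<open>B n\<close> where \<open>|X| \<le> n\<close>, with error \<open>1 / (n + 1)\<close>, and
  left alone elsewhere. The means over \<open>B n\<close> converge to the mean over
  \<open>A\<close>, and the Fatou property yields the limit.\<close>

lemma average_le:
  assumes X: "X \<in> D" and A[measurable]: "A \<in> sets M"
  shows "(\<lambda>x. if x \<in> A then set_mean M A X else X x) \<in> D"
    and "\<rho> (\<lambda>x. if x \<in> A then set_mean M A X else X x) \<le> \<rho> X"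
proof -
  let ?Y = "\<lambda>x. if x \<in> A then set_mean M A X else X x"
  note [measurable] = measurable_D[OF X]
  show Y: "?Y \<in> D"
    by (rule modify_bounded_in_D[OF X A, of _ "\<bar>set_mean M A X\<bar>"]) auto
  show "\<rho> ?Y \<le> \<rho> X"
  proof (cases "prob A = 0")
    case True
    then have "AE x in M. x \<notin> A"
      by (subst AE_iff_measurable[OF A]) (auto simp: emeasure_eq_measure dest: sets.sets_into_space[OF A, THEN subsetD])
    then have "AE x in M. X x = ?Y x" by eventually_elim auto
    then show ?thesis using cong_AE[OF X measurable_D[OF Y]] by simp
  next
    case False
    define B where "B n = {x \<in> space M. x \<in> A \<and> \<bar>X x\<bar> \<le> real n}" for n
    have B[measurable]: "B n \<in> sets M" for n by (simp add: B_def)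
    have BA: "x \<in> A" if "x \<in> B n" for x n using that by (simp add: B_def)
    have ev: "\<forall>\<^sub>F n in sequentially. x \<in> B n" if "x \<in> A" for x
    proof -
      have "x \<in> space M" using that sets.sets_into_space[OF A] by auto
      moreover obtain k :: nat where "\<bar>X x\<bar> \<le> real k" using real_arch_simple by blast
      ultimately have "x \<in> B n" if "k \<le> n" for n
        using that \<open>x \<in> A\<close> by (auto simp: B_def intro: order_trans)
      then show ?thesis by (auto simp: eventually_sequentially)
    qed
    have "incseq B" by (intro incseq_SucI) (auto simp: B_def)
    moreover have U: "(\<Union>n. B n) = A" using BA ev by (force simp: eventually_sequentially)
    moreover have "range B \<subseteq> sets M" by (intro image_subsetI B)
    ultimately have "(\<lambda>n. prob (B n)) \<longlonglongrightarrow> prob A"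
      using finite_Lim_measure_incseq[of B] by simp
    moreover have "(\<lambda>n. \<integral>x. X x * indicator (B n) x \<partial>M) \<longlonglongrightarrow> (\<integral>x. X x * indicator A x \<partial>M)"
    proof (rule integral_dominated_convergence)
      show "integrable M (\<lambda>x. \<bar>X x\<bar>)" using integrable_D[OF X] by simp
      have "(\<lambda>n. X x * indicator (B n) x) \<longlonglongrightarrow> X x * indicator A x" for x
      proof (cases "x \<in> A")
        case True
        have "\<forall>\<^sub>F n in sequentially. X x * indicator (B n) x = X x * indicator A x"
          using ev[OF True] by eventually_elim (use True in simp)
        then show ?thesis by (rule tendsto_eventually)
      next
        case False
        then have "x \<notin> B n" for n using BA by blast
        then show ?thesis using False by simp
      qed
      then show "AE x in M. (\<lambda>n. X x * indicator (B n) x) \<longlonglongrightarrow> X x * indicator A x" by simp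
    qed (auto simp: indicator_def)
    ultimately have mean: "(\<lambda>n. set_mean M (B n) X) \<longlonglongrightarrow> set_mean M A X"
      unfolding set_mean_def using False by (intro tendsto_divide) auto
    then obtain K where K: "\<And>n. \<bar>set_mean M (B n) X\<bar> \<le> K"
      using convergent_imp_Bseq[of "\<lambda>n. set_mean M (B n) X"] unfolding convergent_def Bseq_def
      by (metis real_norm_def)
    define P where "P n Z \<longleftrightarrow> Z \<in> D \<and> \<rho> Z \<le> \<rho> X \<and> (\<forall>x. x \<notin> B n \<longrightarrow> Z x = X x) \<and>
      (AE x in M. x \<in> B n \<longrightarrow> \<bar>Z x - set_mean M (B n) X\<bar> \<le> 1 / real (Suc n))" for n Z
    have "\<exists>Z. P n Z" for n
      using flatten[OF X B, of n "real n" "1 / real (Suc n)"] by (auto simp: B_def P_def)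
    then obtain Z where "\<And>n. P n (Z n)" by metis
    then have Z: "\<And>n. Z n \<in> D" "\<And>n. \<rho> (Z n) \<le> \<rho> X" "\<And>n x. x \<notin> B n \<Longrightarrow> Z n x = X x"
      and ZB: "\<And>n. AE x in M. x \<in> B n \<longrightarrow> \<bar>Z n x - set_mean M (B n) X\<bar> \<le> 1 / real (Suc n)"
      by (simp_all add: P_def)
    have AE_ZB: "AE x in M. \<forall>n. x \<in> B n \<longrightarrow> \<bar>Z n x - set_mean M (B n) X\<bar> \<le> 1 / real (Suc n)"
      using ZB by (simp add: AE_all_countable)
    have "\<rho> ?Y \<le> liminf (\<lambda>n. \<rho> (Z n))"
    proof (rule fatou_dominated[OF Z(1) Y X])
      show "AE x in M. (\<lambda>n. Z n x) \<longlonglongrightarrow> ?Y x"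
        using AE_ZB
      proof eventually_elim
        case (elim x)
        show ?case
        proof (cases "x \<in> A")
          case True
          have "(\<lambda>n. Z n x - set_mean M (B n) X) \<longlonglongrightarrow> 0"
          proof (rule Lim_null_comparison[OF _ LIMSEQ_inverse_real_of_nat])
            show "\<forall>\<^sub>F n in sequentially. norm (Z n x - set_mean M (B n) X) \<le> inverse (real (Suc n))"
              using ev[OF True] by eventually_elim (use elim in \<open>simp add: inverse_eq_divide\<close>)
          qed
          from tendsto_add[OF this mean] show ?thesis using True by simp
        next
          case False
          then have "Z n x = X x" for n using Z(3) BA by blast
          then show ?thesis using False by simp
        qed
      qed
      fix n
      \<comment> \<open>On \<open>B n\<close> the value is within 1 of a mean bounded by
        \<open>K\<close>, off \<open>B n\<close> it is that of \<open>X\<close>; hence the constant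
        \<open>K + 1\<close>.\<close>
      show "AE x in M. \<bar>Z n x\<bar> \<le> \<bar>X x\<bar> + (K + 1)"
        using ZB[of n]
      proof eventually_elim
        case (elim x)
        have 1: "1 / real (Suc n) \<le> 1" by simp
        show ?case
        proof (cases "x \<in> B n")
          case True
          then have "\<bar>Z n x - set_mean M (B n) X\<bar> \<le> 1" using elim 1 by linarith
          then show ?thesis using K[of n] by linarith
        next
          case False
          then show ?thesis using Z(3)[OF False] K[of n] by simp
        qed
      qed
    qed
    also have "\<dots> \<le> liminf (\<lambda>n. \<rho> X)" using Z(2) by (intro Liminf_mono) auto
    also have "\<dots> = \<rho> X" by (simp add: Liminf_const)
    finally show ?thesis .
  qed
qed

end

section \<open>Means over the cells of a partition\<close>

text \<open>An explicit version of the conditional expectation, defined at every point and 0 outside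
  the cells. It can be computed and compared pointwise, and \<open>\<rho>\<close> cannot tell it
  from the abstract one.\<close>

definition partition_mean :: "'a measure \<Rightarrow> 'a set set \<Rightarrow> ('a \<Rightarrow> real) \<Rightarrow> 'a \<Rightarrow> real" where
  "partition_mean M \<pi> X x = (\<Sum>A\<in>\<pi>. set_mean M A X * indicator A x)"

lemma partition_mean_eq:
  assumes "\<pi> \<in> finite_partitions M" "A \<in> \<pi>" "x \<in> A"
  shows "partition_mean M \<pi> X x = set_mean M A X"
proof -
  have fin: "finite \<pi>" and "disjoint \<pi>"
    using assms(1) by (auto simp: finite_partitions_def partition_on_def)
  then have "x \<notin> B" if "B \<in> \<pi>" "B \<noteq> A" for B
    using that assms by (auto simp: disjoint_def)
  then have "(\<Sum>B\<in>\<pi> - {A}. set_mean M B X * indicator B x) = 0"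
    by (intro sum.neutral) auto
  then show ?thesis
    using assms by (simp add: partition_mean_def sum.remove[OF fin assms(2)] del: sum_indicator_eq_card sum_mult_indicator)
qed

lemma finite_partitionsD:
  assumes "\<pi> \<in> finite_partitions M"
  shows "finite \<pi>" "\<And>A. A \<in> \<pi> \<Longrightarrow> A \<in> sets M" "\<And>A. A \<in> \<pi> \<Longrightarrow> measure M A > 0"
    "\<Union>\<pi> = space M" "disjoint \<pi>"
  using assms by (auto simp: finite_partitions_def partition_on_def zero_less_measure_iff)

lemma measurable_partition_mean:
  assumes "\<pi> \<in> finite_partitions M"
  shows "partition_mean M \<pi> X \<in> borel_measurable M"
  unfolding partition_mean_def[abs_def] using finite_partitionsD(2)[OF assms] by measurable

lemma partition_mean_bounded:
  "\<bar>partition_mean M \<pi> X x\<bar> \<le> (\<Sum>A\<in>\<pi>. \<bar>set_mean M A X\<bar>)"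
  unfolding partition_mean_def
  by (rule order_trans[OF sum_abs]) (auto intro!: sum_mono simp: indicator_def)

lemma set_mean_cong_AE:
  assumes [measurable]: "A \<in> sets M" "B \<in> sets M" "X \<in> borel_measurable M"
    and AB: "AE x in M. x \<in> A \<longleftrightarrow> x \<in> B"
  shows "set_mean M A X = set_mean M B X"
proof -
  have "measure M A = measure M B" using AB by (intro measure_eq_AE) auto
  moreover have "(\<integral>x. X x * indicator A x \<partial>M) = (\<integral>x. X x * indicator B x \<partial>M)"
  proof (rule integral_cong_AE)
    show "AE x in M. X x * indicator A x = X x * indicator B x"
      using AB by eventually_elim (auto simp: indicator_def)
  qed measurable
  ultimately show ?thesis by (simp add: set_mean_def)
qed

lemma (in finite_measure) set_mean_between:
  assumes A[measurable]: "A \<in> sets M" and pos: "measure M A > 0" and X: "integrable M X"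
    and bd: "\<And>x. x \<in> A \<Longrightarrow> u \<le> X x \<and> X x \<le> v"
  shows "u \<le> set_mean M A X" "set_mean M A X \<le> v"
proof -
  note int = integrable_real_mult_indicator[OF A]
  have "(\<integral>x. u * indicator A x \<partial>M) \<le> (\<integral>x. X x * indicator A x \<partial>M)"
    by (intro integral_mono int X) (use bd in \<open>auto simp: indicator_def\<close>)
  moreover have "(\<integral>x. X x * indicator A x \<partial>M) \<le> (\<integral>x. v * indicator A x \<partial>M)"
    by (intro integral_mono int X) (use bd in \<open>auto simp: indicator_def\<close>)
  ultimately show "u \<le> set_mean M A X" "set_mean M A X \<le> v"
    using pos by (simp_all add: set_mean_def field_simps)
qed

text \<open>Cells are atoms of the generated sigma-algebra. The property survives complements and
  countable unions, so induction over the generation of \<open>S\<close> applies.\<close>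

lemma sigma_sets_partition:
  assumes "S \<in> sigma_sets \<Omega> \<pi>" "disjoint \<pi>" "\<Union>\<pi> = \<Omega>" "A \<in> \<pi>"
  shows "A \<inter> S = A \<or> A \<inter> S = {}"
  using assms(1)
proof induction
  case (Basic B)
  then show ?case using assms by (auto simp: disjoint_def)
next
  case (Compl B)
  then show ?case using assms by auto
qed auto

text \<open>The defining integral identity over \<open>S\<close> splits along the cells.
  \<open>S\<close> contains a cell entirely, and then the identity is the definition of the mean, or
  misses it.\<close>

lemma (in prob_space) AE_partition_cond_exp:
  assumes \<pi>: "\<pi> \<in> finite_partitions M" and X: "integrable M X"
  shows "AE x in M. partition_cond_exp M \<pi> X x = partition_mean M \<pi> X x"
proof -
  note p = finite_partitionsD[OF \<pi>]
  let ?F = "sigma (space M) \<pi>"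
  have Pow: "\<pi> \<subseteq> Pow (space M)" using p by auto
  have setsF: "sets ?F = sigma_sets (space M) \<pi>" using Pow by simp
  have "subalgebra M ?F"
    unfolding subalgebra_def setsF using Pow p(2) by (auto intro!: sets.sigma_sets_subset simp: space_measure_of)
  then interpret finite_measure_subalgebra M ?F by unfold_locales
  have AF: "A \<in> sets ?F" if "A \<in> \<pi>" for A using that Pow by auto
  have measF: "partition_mean M \<pi> X \<in> borel_measurable ?F"
    unfolding partition_mean_def[abs_def] using AF by measurable
  have intp: "integrable M (partition_mean M \<pi> X)"
    by (rule integrable_const_bound[OF _ measurable_partition_mean[OF \<pi>],
          where B = "\<Sum>A\<in>\<pi>. \<bar>set_mean M A X\<bar>"])
      (simp add: partition_mean_bounded)
  show ?thesis
    unfolding partition_cond_exp_def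
  proof (rule real_cond_exp_charact[OF _ X intp measF])
    fix S assume S: "S \<in> sets ?F"
    then have S': "S \<in> sigma_sets (space M) \<pi>" using setsF by simp
    have SM[measurable]: "S \<in> sets M" using S subalg by (auto simp: subalgebra_def)
    have split: "(\<integral>x\<in>S. Z x \<partial>M) = (\<Sum>A\<in>\<pi>. \<integral>x. Z x * indicator (A \<inter> S) x \<partial>M)"
      if Z: "integrable M Z" for Z :: "'a \<Rightarrow> real"
    proof -
      have "(\<integral>x\<in>S. Z x \<partial>M) = (\<integral>x. (\<Sum>A\<in>\<pi>. Z x * indicator (A \<inter> S) x) \<partial>M)"
        unfolding set_lebesgue_integral_def
      proof (rule Bochner_Integration.integral_cong[OF refl])
        fix x assume "x \<in> space M"
        then obtain A where A: "A \<in> \<pi>" "x \<in> A" using p(4) by auto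
        have "(\<Sum>B\<in>\<pi>. Z x * indicator (B \<inter> S) x) = Z x * indicator (A \<inter> S) x + (\<Sum>B\<in>\<pi>-{A}. Z x * indicator (B \<inter> S) x)"
          by (rule sum.remove[OF p(1) A(1)])
        also have "(\<Sum>B\<in>\<pi>-{A}. Z x * indicator (B \<inter> S) x) = 0"
          using p(5) A by (intro sum.neutral) (auto simp: disjoint_def indicator_def)
        finally show "indicator S x *\<^sub>R Z x = (\<Sum>A\<in>\<pi>. Z x * indicator (A \<inter> S) x)"
          using A by (simp add: indicator_def)
      qed
      also have "\<dots> = (\<Sum>A\<in>\<pi>. \<integral>x. Z x * indicator (A \<inter> S) x \<partial>M)"
        using p(2) by (intro Bochner_Integration.integral_sum integrable_real_mult_indicator Z) auto
      finally show ?thesis .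
    qed
    have "(\<integral>x. X x * indicator (A \<inter> S) x \<partial>M) = (\<integral>x. partition_mean M \<pi> X x * indicator (A \<inter> S) x \<partial>M)"
      if A: "A \<in> \<pi>" for A
    proof (cases "A \<inter> S = A")
      case True
      have "(\<integral>x. partition_mean M \<pi> X x * indicator A x \<partial>M) = (\<integral>x. set_mean M A X * indicator A x \<partial>M)"
        using partition_mean_eq[OF \<pi> A] by (intro Bochner_Integration.integral_cong) (auto simp: indicator_def)
      also have "\<dots> = (\<integral>x. X x * indicator A x \<partial>M)"
        using p(2,3)[OF A] by (simp add: set_mean_def)
      finally show ?thesis using True by simp
    next
      case False
      then have "A \<inter> S = {}" using sigma_sets_partition[OF S' p(5,4) A] by simp
      then show ?thesis by simp
    qed
    then show "(\<integral>x\<in>S. X x \<partial>M) = (\<integral>x\<in>S. partition_mean M \<pi> X x \<partial>M)"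
      by (simp add: split X intp)
  qed
qed

text \<open>The level sets of \<open>g\<close> may be null, which \<open>finite_partitions\<close>
  forbids. Null levels are merged into one level of positive mass, which changes the level sets only
  by null sets and so leaves their means intact.\<close>

lemma (in prob_space) level_set_partition:
  assumes g: "simple_function M g"
  obtains \<pi> where "\<pi> \<in> finite_partitions M"
    "\<forall>X\<in>borel_measurable M. AE x in M. partition_mean M \<pi> X x = set_mean M {y \<in> space M. g y = g x} X"
    "AE x in M. prob {y \<in> space M. g y = g x} > 0"
proof -
  let ?L = "\<lambda>v. {y \<in> space M. g y = v}"
  have L: "?L v \<in> sets M" for v
  proof -
    have "?L v = g -` {v} \<inter> space M" by auto
    then show ?thesis using simple_functionD(2)[OF g] by simp
  qed
  have fin: "finite (g ` space M)" using simple_functionD(1)[OF g] .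
  have "AE x in M. \<forall>v\<in>g ` space M. prob (?L v) = 0 \<longrightarrow> x \<notin> ?L v"
  proof (rule AE_finite_allI[OF fin])
    fix v
    show "AE x in M. prob (?L v) = 0 \<longrightarrow> x \<notin> ?L v"
    proof (cases "prob (?L v) = 0")
      case True
      then have "?L v \<in> null_sets M" using L[of v] by (auto simp: emeasure_eq_measure null_sets_def)
      then show ?thesis using AE_not_in by fastforce
    qed simp
  qed
  then have pos: "AE x in M. prob (?L (g x)) > 0"
    using AE_space by eventually_elim (auto simp: zero_less_measure_iff)
  \<comment> \<open>Otherwise almost no point would exist, which is impossible under a probability
    measure.\<close>
  have "\<exists>x\<in>space M. prob (?L (g x)) > 0"
  proof (rule ccontr)
    assume "\<not> ?thesis"
    then have "AE x in M. False" by (intro AE_mp[OF pos AE_I2]) auto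
    then show False by simp
  qed
  then obtain x0 where x0: "x0 \<in> space M" "prob (?L (g x0)) > 0" by blast
  define h where "h x = (if prob (?L (g x)) > 0 then g x else g x0)" for x
  let ?H = "\<lambda>v. {y \<in> space M. h y = v}"
  have AE_h: "AE x in M. h x = g x" using pos by eventually_elim (simp add: h_def)
  have hg: "h x \<in> g ` space M \<and> prob (?L (h x)) > 0" if "x \<in> space M" for x
    using that x0 by (auto simp: h_def)
  have H: "?H v \<in> sets M" for v
  proof -
    have "?H v = (\<Union>w\<in>{w \<in> g ` space M. (if prob (?L w) > 0 then w else g x0) = v}. ?L w)"
      by (auto simp: h_def)
    also have "\<dots> \<in> sets M" using fin L by (intro sets.finite_UN) auto
    finally show ?thesis .
  qed
  have HL: "AE x in M. x \<in> ?H v \<longleftrightarrow> x \<in> ?L v" for v using AE_h by eventually_elim auto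
  have probH: "prob (?H v) = prob (?L v)" for v
    by (rule finite_measure_eq_AE[OF HL H L])
  define \<pi> where "\<pi> = ?H ` h ` space M"
  have fin': "finite (h ` space M)" by (rule finite_subset[OF _ fin]) (use hg in auto)
  have \<pi>: "\<pi> \<in> finite_partitions M"
    unfolding finite_partitions_def
  proof (intro CollectI conjI ballI)
    show "finite \<pi>" unfolding \<pi>_def using fin' by simp
    show "partition_on (space M) \<pi>"
      by (intro partition_onI) (auto simp: \<pi>_def disjnt_def)
    fix A assume A: "A \<in> \<pi>"
    then show "A \<in> sets M" using H by (auto simp: \<pi>_def)
    show "prob A \<noteq> 0" using A hg by (auto simp: \<pi>_def probH) (metis less_irrefl)
  qed
  have "AE x in M. partition_mean M \<pi> X x = set_mean M (?L (g x)) X"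
    if X: "X \<in> borel_measurable M" for X
    using AE_h AE_space
  proof eventually_elim
    case (elim x)
    have "?H (h x) \<in> \<pi>" unfolding \<pi>_def using elim(2) by (intro imageI)
    moreover have "x \<in> ?H (h x)" using elim(2) by simp
    ultimately have "partition_mean M \<pi> X x = set_mean M (?H (h x)) X"
      by (rule partition_mean_eq[OF \<pi>])
    also have "\<dots> = set_mean M (?L (g x)) X"
      using set_mean_cong_AE[OF H L X HL, of "h x"] elim by simp
    finally show ?case .
  qed
  with \<pi> pos that show ?thesis by blast
qed

text \<open>The cell label of a point: \<open>None\<close> lumps all of \<open>T\<close> into one
  cell, and elsewhere the label is the grid interval of mesh \<open>e\<close> containing the
  value.\<close>

definition discretization :: "'a set \<Rightarrow> ('a \<Rightarrow> real) \<Rightarrow> real \<Rightarrow> 'a \<Rightarrow> int option" where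
  "discretization T X e x = (if x \<in> T then None else Some \<lfloor>X x / e\<rfloor>)"

text \<open>Off \<open>T\<close> the bound \<open>k\<close> leaves finitely many labels. On such a
  cell all values lie in one grid interval of length \<open>e\<close>, so the mean does as well and
  is within \<open>e\<close> of each value.\<close>

lemma (in prob_space) discretize:
  assumes X: "integrable M X" and T[measurable]: "T \<in> sets M"
    and k: "\<And>x. x \<in> space M \<Longrightarrow> x \<notin> T \<Longrightarrow> \<bar>X x\<bar> \<le> k" and e: "e > 0"
  defines "d \<equiv> discretization T X e"
  obtains \<pi> where "\<pi> \<in> finite_partitions M"
    "AE x in M. partition_mean M \<pi> X x = set_mean M {y \<in> space M. d y = d x} X"
    "AE x in M. x \<in> T \<longrightarrow> partition_mean M \<pi> X x = set_mean M T X"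
    "AE x in M. x \<notin> T \<longrightarrow> \<bar>partition_mean M \<pi> X x - X x\<bar> \<le> e"
proof -
  note [measurable] = borel_measurable_integrable[OF X]
  have d: "simple_function M d"
    unfolding simple_function_def
  proof
    have "d ` space M \<subseteq> insert None (Some ` {\<lfloor>- k / e\<rfloor>..\<lfloor>k / e\<rfloor>})"
    proof
      fix v assume "v \<in> d ` space M"
      then obtain x where x: "x \<in> space M" "v = d x" by auto
      show "v \<in> insert None (Some ` {\<lfloor>- k / e\<rfloor>..\<lfloor>k / e\<rfloor>})"
      proof (cases "x \<in> T")
        case False
        then have "- k \<le> X x" "X x \<le> k" using k[OF x(1)] by (simp_all add: abs_le_iff)
        then have "- k / e \<le> X x / e" "X x / e \<le> k / e" using e by (intro divide_right_mono; simp)+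
        then show ?thesis using False x by (auto simp: d_def discretization_def intro!: floor_mono)
      qed (simp add: x d_def discretization_def)
    qed
    then show "finite (d ` space M)" by (rule finite_subset) simp
    have "d -` {v} \<inter> space M \<in> sets M" for v
    proof (cases v)
      case None
      then have "d -` {v} \<inter> space M = T"
        using sets.sets_into_space[OF T] by (auto simp: d_def discretization_def split: if_splits)
      then show ?thesis by simp
    next
      case (Some j)
      then have "d -` {v} \<inter> space M = {x \<in> space M. x \<notin> T \<and> \<lfloor>X x / e\<rfloor> = j}"
        by (auto simp: d_def discretization_def split: if_splits)
      then show ?thesis by simp
    qed
    then show "\<forall>v\<in>d ` space M. d -` {v} \<inter> space M \<in> sets M" by blast
  qed
  obtain \<pi> where part: "\<pi> \<in> finite_partitions M"
    and means: "\<forall>X\<in>borel_measurable M. AE x in M. partition_mean M \<pi> X x = set_mean M {y \<in> space M. d y = d x} X"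
    and pos: "AE x in M. prob {y \<in> space M. d y = d x} > 0"
    by (rule level_set_partition[OF d])
  note \<pi> = part bspec[OF means borel_measurable_integrable[OF X]] pos
  have "AE x in M. x \<in> T \<longrightarrow> partition_mean M \<pi> X x = set_mean M T X"
    using \<pi>(2)
  proof eventually_elim
    case (elim x)
    have "{y \<in> space M. d y = d x} = T" if "x \<in> T"
      using that sets.sets_into_space[OF T] by (auto simp: d_def discretization_def split: if_splits)
    then show ?case using elim by simp
  qed
  moreover have "AE x in M. x \<notin> T \<longrightarrow> \<bar>partition_mean M \<pi> X x - X x\<bar> \<le> e"
    using \<pi>(2,3) AE_space
  proof eventually_elim
    case (elim x)
    show ?case
    proof
      assume x: "x \<notin> T"
      let ?A = "{y \<in> space M. d y = d x}" and ?j = "of_int \<lfloor>X x / e\<rfloor>"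
      have fl: "?j * e \<le> X y \<and> X y \<le> (?j + 1) * e" if "\<lfloor>X y / e\<rfloor> = \<lfloor>X x / e\<rfloor>" for y
      proof -
        have "?j \<le> X y / e" "X y / e \<le> ?j + 1" unfolding that[symmetric] by linarith+
        then show ?thesis using e by (simp add: field_simps)
      qed
      have A: "?j * e \<le> X y \<and> X y \<le> (?j + 1) * e" if "y \<in> ?A" for y
        using that x by (intro fl) (auto simp: d_def discretization_def split: if_splits)
      have "?A = d -` {d x} \<inter> space M" by auto
      then have "?A \<in> sets M" using simple_functionD(2)[OF d, of "{d x}"] by simp
      from set_mean_between[OF this elim(2) X A]
      have "?j * e \<le> partition_mean M \<pi> X x" "partition_mean M \<pi> X x \<le> (?j + 1) * e"
        using elim(1) by auto
      moreover have "?j * e \<le> X x \<and> X x \<le> (?j + 1) * e" by (rule fl) simp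
      moreover have "(?j + 1) * e = ?j * e + e" by (simp add: algebra_simps)
      ultimately show "\<bar>partition_mean M \<pi> X x - X x\<bar> \<le> e" by (simp add: abs_le_iff)
    qed
  qed
  ultimately show ?thesis using that \<pi> by blast
qed

section \<open>Dilatation monotonicity and the extension\<close>

lemma set_mean_linear:
  assumes A: "A \<in> sets M" and X: "integrable M X" and Y: "integrable M Y"
  shows "set_mean M A (\<lambda>x. a * X x + b * Y x) = a * set_mean M A X + b * set_mean M A Y"
proof -
  note int = integrable_real_mult_indicator[OF A]
  have "(\<integral>x. (a * X x + b * Y x) * indicator A x \<partial>M) =
      (\<integral>x. a * (X x * indicator A x) + b * (Y x * indicator A x) \<partial>M)"
    by (simp add: algebra_simps)
  also have "\<dots> = a * (\<integral>x. X x * indicator A x \<partial>M) + b * (\<integral>x. Y x * indicator A x \<partial>M)"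
    using int[OF X] int[OF Y] by simp
  finally show ?thesis by (simp add: set_mean_def add_divide_distrib)
qed

lemma partition_mean_linear:
  assumes "\<pi> \<in> finite_partitions M" "integrable M X" "integrable M Y"
  shows "partition_mean M \<pi> (\<lambda>x. a * X x + b * Y x) x =
    a * partition_mean M \<pi> X x + b * partition_mean M \<pi> Y x"
proof -
  have "set_mean M A (\<lambda>x. a * X x + b * Y x) * indicator A x =
      a * (set_mean M A X * indicator A x) + b * (set_mean M A Y * indicator A x)" if "A \<in> \<pi>" for A
    using set_mean_linear[OF finite_partitionsD(2)[OF assms(1) that] assms(2,3)]
    by (simp add: algebra_simps)
  then show ?thesis
    unfolding partition_mean_def sum_distrib_left sum.distrib[symmetric] by (rule sum.cong[OF refl])
qed

lemma (in finite_measure) partition_mean_const: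
  assumes \<pi>: "\<pi> \<in> finite_partitions M" and x: "x \<in> space M"
  shows "partition_mean M \<pi> (\<lambda>x. s) x = s"
proof -
  obtain A where A: "A \<in> \<pi>" "x \<in> A" using finite_partitionsD(4)[OF \<pi>] x by auto
  then show ?thesis
    using partition_mean_eq[OF \<pi> A] finite_partitionsD(2,3)[OF \<pi> A(1)] by (simp add: set_mean_def)
qed

lemma partition_mean_mono:
  assumes \<pi>: "\<pi> \<in> finite_partitions M" and X: "integrable M X" and Y: "integrable M Y"
    and le: "AE x in M. X x \<le> Y x"
  shows "partition_mean M \<pi> X x \<le> partition_mean M \<pi> Y x"
  unfolding partition_mean_def
proof (rule sum_mono)
  fix A assume "A \<in> \<pi>"
  then have A: "A \<in> sets M" by (rule finite_partitionsD(2)[OF \<pi>])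
  have "(\<integral>x. X x * indicator A x \<partial>M) \<le> (\<integral>x. Y x * indicator A x \<partial>M)"
    by (intro integral_mono_AE integrable_real_mult_indicator A X Y)
      (use le in \<open>auto elim!: eventually_mono simp: indicator_def\<close>)
  then show "set_mean M A X * indicator A x \<le> set_mean M A Y * indicator A x"
    by (simp add: set_mean_def divide_right_mono mult_right_mono)
qed

lemma tendsto_tail_integral:
  fixes X :: "'a \<Rightarrow> real"
  assumes X: "integrable M X"
  shows "(\<lambda>n. \<integral>x. \<bar>X x\<bar> * indicator {x \<in> space M. \<bar>X x\<bar> > real n} x \<partial>M) \<longlonglongrightarrow> 0"
proof -
  note [measurable] = borel_measurable_integrable[OF X]
  have "(\<lambda>n. \<integral>x. \<bar>X x\<bar> * indicator {x \<in> space M. \<bar>X x\<bar> > real n} x \<partial>M) \<longlonglongrightarrow> (\<integral>x. 0 \<partial>M)"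
  proof (rule integral_dominated_convergence)
    show "integrable M (\<lambda>x. \<bar>X x\<bar>)" using X by simp
    show "AE x in M. (\<lambda>n. \<bar>X x\<bar> * indicator {x \<in> space M. \<bar>X x\<bar> > real n} x) \<longlonglongrightarrow> 0"
    proof (rule AE_I2)
      fix x
      obtain k :: nat where k: "\<bar>X x\<bar> \<le> real k" using real_arch_simple by blast
      have "\<forall>\<^sub>F n in sequentially. \<bar>X x\<bar> * indicator {x \<in> space M. \<bar>X x\<bar> > real n} x = 0"
        using eventually_ge_at_top[of k] by eventually_elim (use k in auto)
      then show "(\<lambda>n. \<bar>X x\<bar> * indicator {x \<in> space M. \<bar>X x\<bar> > real n} x) \<longlonglongrightarrow> 0"
        by (rule tendsto_eventually)
    qed
  qed (auto simp: indicator_def)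
  then show ?thesis by simp
qed

context fatou_functional
begin

text \<open>Cell means take finitely many values, so they are bounded and \<open>\<rho>\<close> is
  defined at them whether or not \<open>X\<close> lies in the domain.\<close>

lemma partition_mean_in_D: "\<pi> \<in> finite_partitions M \<Longrightarrow> partition_mean M \<pi> X \<in> D"
  by (rule bounded_in_D[OF measurable_partition_mean, where c = "\<Sum>A\<in>\<pi>. \<bar>set_mean M A X\<bar>"])
    (simp_all add: partition_mean_bounded)

lemma partition_cond_exp_eq:
  assumes \<pi>: "\<pi> \<in> finite_partitions M" and X: "integrable M X"
  shows "partition_cond_exp M \<pi> X \<in> D" "\<rho> (partition_cond_exp M \<pi> X) = \<rho> (partition_mean M \<pi> X)"
proof -
  have "AE x in M. partition_mean M \<pi> X x = partition_cond_exp M \<pi> X x"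
    using AE_partition_cond_exp[OF \<pi> X] by eventually_elim simp
  moreover have "partition_cond_exp M \<pi> X \<in> borel_measurable M"
    unfolding partition_cond_exp_def by (rule borel_measurable_cond_exp2)
  ultimately show "partition_cond_exp M \<pi> X \<in> D" "\<rho> (partition_cond_exp M \<pi> X) = \<rho> (partition_mean M \<pi> X)"
    using cong_AE[OF partition_mean_in_D[OF \<pi>]] by blast+
qed

lemma extension_eq:
  "integrable M X \<Longrightarrow> dilatation_extension M \<rho> X = (SUP \<pi>\<in>finite_partitions M. \<rho> (partition_mean M \<pi> X))"
  unfolding dilatation_extension_def by (intro SUP_cong refl partition_cond_exp_eq)

lemma le_extension:
  "integrable M X \<Longrightarrow> \<pi> \<in> finite_partitions M \<Longrightarrow> \<rho> (partition_mean M \<pi> X) \<le> dilatation_extension M \<rho> X"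
  by (subst extension_eq) (auto intro: SUP_upper)

lemma extension_le:
  assumes "integrable M X" "\<And>\<pi>. \<pi> \<in> finite_partitions M \<Longrightarrow> \<rho> (partition_mean M \<pi> X) \<le> r"
  shows "dilatation_extension M \<rho> X \<le> r"
  using assms by (subst extension_eq) (auto intro: SUP_least)

text \<open>The cells are averaged one after another: \<open>Z Q\<close> is averaged on the cells in
  \<open>Q\<close> and equals \<open>X\<close> elsewhere. As the cells are disjoint, earlier steps
  do not change the mean over the next one.\<close>

lemma partition_mean_le:
  assumes \<pi>: "\<pi> \<in> finite_partitions M" and X: "X \<in> D"
  shows "\<rho> (partition_mean M \<pi> X) \<le> \<rho> X"
proof -
  note p = finite_partitionsD[OF \<pi>]
  define Z where "Z Q x = (if x \<in> \<Union>Q then partition_mean M \<pi> X x else X x)" for Q x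
  have "Z Q \<in> D \<and> \<rho> (Z Q) \<le> \<rho> X" if "Q \<subseteq> \<pi>" for Q
    using finite_subset[OF that p(1)] that
  proof (induction Q)
    case empty
    then show ?case using X by (simp add: Z_def[abs_def])
  next
    case (insert A Q)
    then have A: "A \<in> \<pi>" "A \<in> sets M" using p(2) by auto
    have disj: "x \<notin> \<Union>Q" if "x \<in> A" for x
      using that insert.prems insert.hyps(2) p(5) disjointD[of \<pi> A] by blast
    have "set_mean M A (Z Q) = set_mean M A X"
      unfolding set_mean_def using disj
      by (intro arg_cong2[where f = "(/)"] Bochner_Integration.integral_cong refl)
        (auto simp: indicator_def Z_def)
    then have "(\<lambda>x. if x \<in> A then set_mean M A (Z Q) else Z Q x) = Z (insert A Q)"
      using partition_mean_eq[OF \<pi> A(1)] by (auto simp: Z_def fun_eq_iff)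
    then show ?case
      using average_le[of "Z Q" A] insert A by (auto intro: order_trans)
  qed
  then have Z: "Z \<pi> \<in> D" "\<rho> (Z \<pi>) \<le> \<rho> X" by auto
  have "AE x in M. Z \<pi> x = partition_mean M \<pi> X x"
    using p(4) by (intro AE_I2) (simp add: Z_def)
  then show ?thesis
    using cong_AE(2)[OF Z(1) measurable_partition_mean[OF \<pi>]] Z(2) by simp
qed

text \<open>
  Discretising \<open>X\<close> on \<open>{\<bar>X\<bar> \<le> k}\<close> and averaging over the tail does not give a dominated
  sequence, since the mean over the tail need not be controlled by \<open>\<bar>X\<bar>\<close>. The tail is therefore
  joined with a set \<open>C n\<close> of bounded values whose probability is small, but at least the integral
  of \<open>\<bar>X\<bar>\<close> over the tail.
\<close>

lemma le_extension_on_D: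
  assumes X: "X \<in> D"
  shows "\<rho> X \<le> dilatation_extension M \<rho> X"
proof -
  note intX = integrable_D[OF X]
  note [measurable] = measurable_D[OF X]
  let ?tail = "\<lambda>n. {x \<in> space M. \<bar>X x\<bar> > real n}"
  obtain m :: nat where m: "prob {x \<in> space M. \<bar>X x\<bar> \<le> real m} > 0"
  proof -
    have "(\<Union>m::nat. {x \<in> space M. \<bar>X x\<bar> \<le> real m}) = space M"
      using real_arch_simple by auto
    moreover have "incseq (\<lambda>m::nat. {x \<in> space M. \<bar>X x\<bar> \<le> real m})"
      by (intro incseq_SucI) auto
    moreover have "range (\<lambda>m::nat. {x \<in> space M. \<bar>X x\<bar> \<le> real m}) \<subseteq> sets M" by auto
    ultimately have "(\<lambda>m. prob {x \<in> space M. \<bar>X x\<bar> \<le> real m}) \<longlonglongrightarrow> 1"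
      using finite_Lim_measure_incseq[of "\<lambda>m::nat. {x \<in> space M. \<bar>X x\<bar> \<le> real m}"] prob_space by simp
    then have "\<forall>\<^sub>F m in sequentially. 0 < prob {x \<in> space M. \<bar>X x\<bar> \<le> real m}"
      by (rule order_tendstoD) simp
    then show ?thesis using that by (auto simp: eventually_sequentially)
  qed
  \<comment> \<open>The geometric bound makes the masses summable, so by Borel-Cantelli almost every
    point eventually leaves \<open>C n\<close>.\<close>
  have "\<exists>C. C \<in> sets M \<and> C \<subseteq> {x \<in> space M. \<bar>X x\<bar> \<le> real m} \<and> 0 < prob C \<and> prob C < (1/2) ^ n" for n
    by (rule nonatomic_small_subset[OF nonatomic _ m, of "(1/2) ^ n"]) auto
  then obtain C where C: "\<And>n. C n \<in> sets M" "\<And>n. C n \<subseteq> {x \<in> space M. \<bar>X x\<bar> \<le> real m}"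
    "\<And>n. 0 < prob (C n)" "\<And>n. prob (C n) < (1/2) ^ n" by metis
  \<comment> \<open>The truncation level is chosen after \<open>C n\<close>, so that the tail
    integral fits below its mass; \<open>k n \<ge> n\<close> makes every point eventually leave the
    tail.\<close>
  have "\<exists>k\<ge>n. (\<integral>x. \<bar>X x\<bar> * indicator (?tail k) x \<partial>M) \<le> prob (C n)" for n
  proof -
    have "\<forall>\<^sub>F k in sequentially. (\<integral>x. \<bar>X x\<bar> * indicator (?tail k) x \<partial>M) < prob (C n)"
      using order_tendstoD(2)[OF tendsto_tail_integral[OF intX] C(3)] .
    then have "\<forall>\<^sub>F k in sequentially. k \<ge> n \<and> (\<integral>x. \<bar>X x\<bar> * indicator (?tail k) x \<partial>M) \<le> prob (C n)"
      using eventually_ge_at_top[of n] by eventually_elim simp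
    then show ?thesis by (auto simp: eventually_sequentially)
  qed
  then obtain k where k: "\<And>n. k n \<ge> n"
    "\<And>n. (\<integral>x. \<bar>X x\<bar> * indicator (?tail (k n)) x \<partial>M) \<le> prob (C n)" by metis
  define T where "T n = ?tail (k n) \<union> C n" for n
  have T[measurable]: "T n \<in> sets M" for n using C(1) by (simp add: T_def)
  \<comment> \<open>The tail contributes at most \<open>prob (C n)\<close> and \<open>C n\<close> at
    most \<open>m * prob (C n)\<close>; dividing by \<open>prob (T n) \<ge> prob (C n)\<close> gives
    \<open>1 + m\<close>, uniformly in \<open>n\<close>.\<close>
  have mean_T: "\<bar>set_mean M (T n) X\<bar> \<le> 1 + real m" for n
  proof -
    have pT: "prob (C n) \<le> prob (T n)" using C(1) by (intro finite_measure_mono) (auto simp: T_def)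
    have "\<bar>\<integral>x. X x * indicator (T n) x \<partial>M\<bar> \<le> (\<integral>x. \<bar>X x * indicator (T n) x\<bar> \<partial>M)"
      by (rule integral_abs_bound)
    also have "\<dots> \<le> (\<integral>x. \<bar>X x\<bar> * indicator (?tail (k n)) x + real m * indicator (C n) x \<partial>M)"
    proof (rule integral_mono)
      show "integrable M (\<lambda>x. \<bar>X x * indicator (T n) x\<bar>)"
        using integrable_real_mult_indicator[OF T intX] by simp
      show "integrable M (\<lambda>x. \<bar>X x\<bar> * indicator (?tail (k n)) x + real m * indicator (C n) x)"
        using C(1) intX by (intro Bochner_Integration.integrable_add integrable_real_mult_indicator) auto
      show "\<bar>X x * indicator (T n) x\<bar> \<le> \<bar>X x\<bar> * indicator (?tail (k n)) x + real m * indicator (C n) x"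
        if "x \<in> space M" for x
        using C(2)[of n] by (auto simp: T_def indicator_def)
    qed
    also have "\<dots> = (\<integral>x. \<bar>X x\<bar> * indicator (?tail (k n)) x \<partial>M) + real m * prob (C n)"
    proof (subst Bochner_Integration.integral_add)
      show "integrable M (\<lambda>x. \<bar>X x\<bar> * indicator (?tail (k n)) x)"
        using intX by (intro integrable_real_mult_indicator) auto
      show "integrable M (\<lambda>x. real m * indicator (C n) x)"
        using C(1) by (intro integrable_real_mult_indicator) auto
    qed (use C(1) in simp)
    also have "\<dots> \<le> (1 + real m) * prob (T n)"
      using k(2)[of n] pT mult_left_mono[OF pT, of "real m"] by (simp add: algebra_simps)
    finally show ?thesis
      using pT C(3)[of n] by (simp add: set_mean_def abs_divide field_simps)
  qed
  define P where "P n \<pi> \<longleftrightarrow> \<pi> \<in> finite_partitions M \<and>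
    (AE x in M. x \<in> T n \<longrightarrow> partition_mean M \<pi> X x = set_mean M (T n) X) \<and>
    (AE x in M. x \<notin> T n \<longrightarrow> \<bar>partition_mean M \<pi> X x - X x\<bar> \<le> 1 / real (Suc n))" for n \<pi>
  have "\<exists>\<pi>. P n \<pi>" for n
  proof -
    have "\<bar>X x\<bar> \<le> real (k n)" if "x \<in> space M" "x \<notin> T n" for x using that by (auto simp: T_def)
    then show ?thesis
      using discretize[OF intX T, of n "real (k n)" "1 / real (Suc n)"] unfolding P_def by auto
  qed
  then obtain \<pi> where "\<And>n. P n (\<pi> n)" by metis
  then have \<pi>: "\<And>n. \<pi> n \<in> finite_partitions M"
    and inT: "\<And>n. AE x in M. x \<in> T n \<longrightarrow> partition_mean M (\<pi> n) X x = set_mean M (T n) X"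
    and offT: "\<And>n. AE x in M. x \<notin> T n \<longrightarrow> \<bar>partition_mean M (\<pi> n) X x - X x\<bar> \<le> 1 / real (Suc n)"
    by (simp_all add: P_def)
  have "AE x in M. \<forall>\<^sub>F n in sequentially. x \<in> space M - C n"
  proof (rule borel_cantelli_AE1)
    show "summable (\<lambda>n. prob (C n))"
      by (rule summable_comparison_test'[OF summable_geometric[of "1/2 :: real"]])
        (use C(4) in \<open>auto intro: less_imp_le\<close>)
  qed (use C(1) in \<open>auto simp: emeasure_eq_measure\<close>)
  then have evT: "AE x in M. \<forall>\<^sub>F n in sequentially. x \<notin> T n"
  proof eventually_elim
    case (elim x)
    obtain j :: nat where j: "\<bar>X x\<bar> \<le> real j" using real_arch_simple by blast
    show ?case
      using elim eventually_ge_at_top[of j]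
    proof eventually_elim
      case (elim n)
      then have "real j \<le> real (k n)" using k(1)[of n] by simp
      then show ?case using elim j by (auto simp: T_def)
    qed
  qed
  have "\<rho> X \<le> liminf (\<lambda>n. \<rho> (partition_mean M (\<pi> n) X))"
  proof (rule fatou_dominated[OF partition_mean_in_D[OF \<pi>] X X])
    have "AE x in M. \<forall>n. x \<notin> T n \<longrightarrow> \<bar>partition_mean M (\<pi> n) X x - X x\<bar> \<le> 1 / real (Suc n)"
      using offT by (simp add: AE_all_countable)
    then show "AE x in M. (\<lambda>n. partition_mean M (\<pi> n) X x) \<longlonglongrightarrow> X x"
      using evT
    proof eventually_elim
      case (elim x)
      have "(\<lambda>n. partition_mean M (\<pi> n) X x - X x) \<longlonglongrightarrow> 0"
      proof (rule Lim_null_comparison[OF _ LIMSEQ_inverse_real_of_nat])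
        show "\<forall>\<^sub>F n in sequentially. norm (partition_mean M (\<pi> n) X x - X x) \<le> inverse (real (Suc n))"
          using elim(2) by eventually_elim (use elim(1) in \<open>simp add: inverse_eq_divide\<close>)
      qed
      then show ?case by (rule LIM_zero_cancel)
    qed
    fix n
    show "AE x in M. \<bar>partition_mean M (\<pi> n) X x\<bar> \<le> \<bar>X x\<bar> + (1 + real m)"
      using inT[of n] offT[of n]
    proof eventually_elim
      case (elim x)
      have 1: "1 / real (Suc n) \<le> 1" by simp
      show ?case
      proof (cases "x \<in> T n")
        case True
        then show ?thesis using elim mean_T[of n] by simp
      next
        case False
        then have "\<bar>partition_mean M (\<pi> n) X x - X x\<bar> \<le> 1" using elim 1 by linarith
        then show ?thesis by linarith
      qed
    qed
  qed
  also have "\<dots> \<le> liminf (\<lambda>n. dilatation_extension M \<rho> X)"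
    using le_extension[OF intX \<pi>] by (intro Liminf_mono) auto
  also have "\<dots> = dilatation_extension M \<rho> X" by (simp add: Liminf_const)
  finally show ?thesis .
qed

lemma extension_on_D: "X \<in> D \<Longrightarrow> dilatation_extension M \<rho> X = \<rho> X"
  by (intro antisym extension_le le_extension_on_D partition_mean_le integrable_D)

end

section \<open>Properties of the extension\<close>

lemma topspace_weak_L1: "topspace (weak_L1_topology M) = L1_space M"
proof -
  have "{X \<in> L1_space M. (\<integral>x. X x * 0 \<partial>M) \<in> (UNIV :: real set)} \<in>
      {{X \<in> L1_space M. (\<integral>x. X x * Y x \<partial>M) \<in> U} | Y U. simple_function M Y \<and> open U}"
    by (intro CollectI exI[of _ "\<lambda>x. 0"] exI[of _ UNIV]) auto
  then show ?thesis by (auto simp: weak_L1_topology_def topology_generated_by_topspace)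
qed

lemma openin_weak_L1:
  assumes "A \<in> sets M"
  shows "openin (weak_L1_topology M) {Y \<in> L1_space M. \<bar>(\<integral>x. Y x * indicator A x \<partial>M) - c\<bar> < \<delta>}"
proof -
  have "{Y \<in> L1_space M. \<bar>(\<integral>x. Y x * indicator A x \<partial>M) - c\<bar> < \<delta>} =
      {Y \<in> L1_space M. (\<integral>x. Y x * indicator A x \<partial>M) \<in> ball c \<delta>}"
    by (auto simp: dist_real_def abs_minus_commute)
  moreover have "simple_function M (indicator A :: _ \<Rightarrow> real)" using assms by simp
  ultimately show ?thesis
    unfolding weak_L1_topology_def by (intro topology_generated_by_Basis) blast
qed

context fatou_functional
begin

text \<open>If no \<open>\<delta>\<close> worked, there would be \<open>Y n\<close> whose cell
  integrals are within \<open>1 / (n + 1)\<close> of those of \<open>X\<close> although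
  \<open>\<rho>\<close> stays at most \<open>l\<close>. Their cell means converge everywhere and are
  uniformly bounded, so the Fatou property applies with dominating variable 0. The form with
  \<open>\<delta>\<close> serves both weak lower semicontinuity and law invariance.\<close>

lemma partition_mean_nhd:
  assumes \<pi>: "\<pi> \<in> finite_partitions M" and X: "integrable M X" and l: "l < \<rho> (partition_mean M \<pi> X)"
  obtains \<delta> where "\<delta> > 0"
    "\<And>Y. integrable M Y \<Longrightarrow>
      (\<And>A. A \<in> \<pi> \<Longrightarrow> \<bar>(\<integral>x. Y x * indicator A x \<partial>M) - (\<integral>x. X x * indicator A x \<partial>M)\<bar> < \<delta>) \<Longrightarrow>
      l < \<rho> (partition_mean M \<pi> Y)"
proof (rule ccontr)
  note p = finite_partitionsD[OF \<pi>]
  let ?i = "\<lambda>Y A. \<integral>x. Y x * indicator A x \<partial>M"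
  define P where "P n Y \<longleftrightarrow> (\<forall>A\<in>\<pi>. \<bar>?i Y A - ?i X A\<bar> < inverse (real (Suc n))) \<and>
    \<rho> (partition_mean M \<pi> Y) \<le> l" for n Y
  assume contr: "\<not> thesis"
  have "\<exists>Y. P n Y" for n
    using contr that[of "inverse (real (Suc n))"] unfolding P_def by (force simp: not_less)
  then obtain Y where "\<And>n. P n (Y n)" by metis
  then have Y: "\<And>n A. A \<in> \<pi> \<Longrightarrow> \<bar>?i (Y n) A - ?i X A\<bar> < inverse (real (Suc n))"
    "\<And>n. \<rho> (partition_mean M \<pi> (Y n)) \<le> l" by (auto simp: P_def)
  have lim: "(\<lambda>n. set_mean M A (Y n)) \<longlonglongrightarrow> set_mean M A X" if A: "A \<in> \<pi>" for A
  proof -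
    have "(\<lambda>n. ?i (Y n) A - ?i X A) \<longlonglongrightarrow> 0"
      by (rule Lim_null_comparison[OF _ LIMSEQ_inverse_real_of_nat])
        (use Y(1)[OF A] in \<open>auto intro!: always_eventually less_imp_le\<close>)
    from LIM_zero_cancel[OF this] show ?thesis
      unfolding set_mean_def using p(3)[OF A] by (intro tendsto_divide tendsto_const) auto
  qed
  have bound: "\<bar>set_mean M A (Y n)\<bar> \<le> \<bar>set_mean M A X\<bar> + 1 / prob A" if A: "A \<in> \<pi>" for A n
  proof -
    have "inverse (real (Suc n)) \<le> 1" by (simp add: inverse_eq_divide)
    then have "\<bar>?i (Y n) A\<bar> \<le> \<bar>?i X A\<bar> + 1" using Y(1)[OF A, of n] by linarith
    then have "\<bar>?i (Y n) A\<bar> / prob A \<le> (\<bar>?i X A\<bar> + 1) / prob A" by (intro divide_right_mono) auto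
    then show ?thesis by (simp add: set_mean_def abs_divide add_divide_distrib)
  qed
  \<comment> \<open>The integrals over a cell differ by less than 1, so the means differ by at most
    \<open>1 / prob A\<close>.\<close>
  let ?c = "\<Sum>A\<in>\<pi>. \<bar>set_mean M A X\<bar> + 1 / prob A"
  have "\<rho> (partition_mean M \<pi> X) \<le> liminf (\<lambda>n. \<rho> (partition_mean M \<pi> (Y n)))"
  proof (rule fatou_dominated[OF partition_mean_in_D[OF \<pi>] partition_mean_in_D[OF \<pi>]])
    show "(\<lambda>x. 0) \<in> D" by (rule bounded_in_D[of _ 0]) auto
    show "AE x in M. (\<lambda>n. partition_mean M \<pi> (Y n) x) \<longlonglongrightarrow> partition_mean M \<pi> X x"
      unfolding partition_mean_def by (intro AE_I2 tendsto_intros lim)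
    fix n
    have "\<bar>partition_mean M \<pi> (Y n) x\<bar> \<le> ?c" for x
      by (rule order_trans[OF partition_mean_bounded sum_mono[OF bound]])
    then show "AE x in M. \<bar>partition_mean M \<pi> (Y n) x\<bar> \<le> \<bar>0\<bar> + ?c" by simp
  qed
  also have "\<dots> \<le> liminf (\<lambda>n. l)" using Y(2) by (intro Liminf_mono) auto
  also have "\<dots> = l" by (simp add: Liminf_const)
  finally show False using l by simp
qed

lemma extension_weakly_lsc: "lower_semicontinuous (weak_L1_topology M) (L1_space M) (dilatation_extension M \<rho>)"
  unfolding lower_semicontinuous_def closedin_def topspace_weak_L1
proof (intro allI conjI)
  fix l :: real
  let ?S = "L1_space M - {X \<in> L1_space M. dilatation_extension M \<rho> X \<le> ereal l}"
  show "openin (weak_L1_topology M) ?S"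
  proof (subst openin_subopen, intro ballI)
    fix X assume "X \<in> ?S"
    then have X: "integrable M X" and less: "ereal l < dilatation_extension M \<rho> X"
      by (auto simp: L1_space_def)
    then obtain \<pi> where \<pi>: "\<pi> \<in> finite_partitions M" "ereal l < \<rho> (partition_mean M \<pi> X)"
      by (auto simp: extension_eq less_SUP_iff)
    obtain \<delta> where \<delta>: "\<delta> > 0" "\<And>Y. integrable M Y \<Longrightarrow>
      (\<And>A. A \<in> \<pi> \<Longrightarrow> \<bar>(\<integral>x. Y x * indicator A x \<partial>M) - (\<integral>x. X x * indicator A x \<partial>M)\<bar> < \<delta>) \<Longrightarrow>
      ereal l < \<rho> (partition_mean M \<pi> Y)"
      using partition_mean_nhd[OF \<pi>(1) X \<pi>(2)] by metis
    let ?V = "\<lambda>A. {Y \<in> L1_space M. \<bar>(\<integral>x. Y x * indicator A x \<partial>M) - (\<integral>x. X x * indicator A x \<partial>M)\<bar> < \<delta>}"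
    \<comment> \<open>An intersection over no cells would be all functions instead of the integrable
      ones.\<close>
    have "\<pi> \<noteq> {}" using finite_partitionsD(4)[OF \<pi>(1)] not_empty by auto
    then have "openin (weak_L1_topology M) (\<Inter>(?V ` \<pi>))"
      using finite_partitionsD(1,2)[OF \<pi>(1)]
      by (intro openin_Inter) (auto intro!: openin_weak_L1)
    moreover have "X \<in> \<Inter>(?V ` \<pi>)" using X \<delta>(1) by (auto simp: L1_space_def)
    moreover have "Y \<in> ?S" if Y: "Y \<in> \<Inter>(?V ` \<pi>)" for Y
    proof -
      have intY: "integrable M Y" using Y \<open>\<pi> \<noteq> {}\<close> by (auto simp: L1_space_def)
      have "ereal l < \<rho> (partition_mean M \<pi> Y)" using Y by (intro \<delta>(2) intY) auto
      also have "\<dots> \<le> dilatation_extension M \<rho> Y" by (rule le_extension[OF intY \<pi>(1)])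
      finally show ?thesis using intY by (auto simp: L1_space_def)
    qed
    ultimately show "\<exists>T. openin (weak_L1_topology M) T \<and> X \<in> T \<and> T \<subseteq> ?S" by blast
  qed
qed auto

text \<open>The mean over the cell of \<open>x\<close> is a function \<open>f\<close> of the value
  \<open>X x\<close>, and \<open>f\<close> is computed from the law of \<open>X\<close> alone: it
  averages the identity over level sets of \<open>h\<close> under that law. The same
  \<open>f\<close> serves \<open>Y\<close>, so both discretizations are images of one law.\<close>

lemma discretized_law:
  assumes X: "integrable M X" and Y: "integrable M Y" and law: "distr M borel X = distr M borel Y"
    and X': "X' \<in> D" "AE x in M. X' x = set_mean M {y \<in> space M. h (X y) = h (X x)} X"
    and Y': "Y' \<in> D" "AE x in M. Y' x = set_mean M {y \<in> space M. h (Y y) = h (Y x)} Y"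
    and h[measurable]: "h \<in> measurable borel (count_space (UNIV :: int option set))"
  shows "\<rho> X' = \<rho> Y'"
proof -
  let ?\<nu> = "distr M borel X"
  define f where "f r = set_mean ?\<nu> {s. h s = h r} (\<lambda>s. s)" for r
  have [measurable]: "{s. h s = v} \<in> sets borel" for v
  proof -
    have "{s. h s = v} = h -` {v} \<inter> space borel" by auto
    then show ?thesis using measurable_sets[OF h, of "{v}"] by simp
  qed
  have [measurable]: "f \<in> borel_measurable borel"
  proof -
    have "(\<lambda>v. set_mean ?\<nu> {s. h s = v} (\<lambda>s. s)) \<in> measurable (count_space UNIV) borel" by simp
    from measurable_compose[OF h this] show ?thesis by (simp add: f_def[abs_def])
  qed
  have f: "set_mean M {y \<in> space M. h (Z y) = h (Z x)} Z = f (Z x)"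
    if [measurable]: "Z \<in> borel_measurable M" and Z: "distr M borel Z = ?\<nu>" for Z x
  proof -
    have "set_mean (distr M borel Z) {s. h s = h (Z x)} (\<lambda>s. s) =
        (\<integral>y. Z y * indicator {s. h s = h (Z x)} (Z y) \<partial>M) / prob (Z -` {s. h s = h (Z x)} \<inter> space M)"
      unfolding set_mean_def by (simp add: integral_distr measure_distr)
    also have "\<dots> = set_mean M {y \<in> space M. h (Z y) = h (Z x)} Z"
      unfolding set_mean_def
      by (intro arg_cong2[where f = "(/)"] Bochner_Integration.integral_cong arg_cong[where f = prob] refl)
        (auto simp: indicator_def)
    finally show ?thesis by (simp add: f_def Z)
  qed
  note [measurable] = borel_measurable_integrable[OF X] borel_measurable_integrable[OF Y]
    measurable_D[OF X'(1)] measurable_D[OF Y'(1)]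
  have "distr M borel X' = distr M borel (\<lambda>x. f (X x))"
    using X'(2) by (intro distr_cong_AE) (simp_all add: f)
  also have "\<dots> = distr (distr M borel X) borel f" by (simp add: distr_distr comp_def)
  also have "\<dots> = distr M borel (\<lambda>x. f (Y x))" unfolding law by (simp add: distr_distr comp_def)
  also have "distr M borel (\<lambda>x. f (Y x)) = distr M borel Y'"
    using Y'(2) by (intro distr_cong_AE[symmetric]) (simp_all add: f law)
  finally show ?thesis by (rule law_cong[OF X'(1) Y'(1)])
qed

text \<open>\<open>X\<close> is first replaced by its own discretization \<open>?X\<close>, close
  enough in L1 for its mean over \<open>\<pi>\<close> still to exceed \<open>l\<close> under
  \<open>\<rho>\<close>. Dilatation monotonicity on the domain then removes \<open>\<pi>\<close>,
  and what remains depends only on the law and passes to \<open>Y\<close>.\<close>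

lemma extension_law_le:
  assumes X: "integrable M X" and Y: "integrable M Y" and law: "distr M borel X = distr M borel Y"
  shows "dilatation_extension M \<rho> X \<le> dilatation_extension M \<rho> Y"
proof (rule extension_le[OF X], rule dense_le)
  fix \<pi> l assume \<pi>: "\<pi> \<in> finite_partitions M" and l: "l < \<rho> (partition_mean M \<pi> X)"
  note [measurable] = borel_measurable_integrable[OF X] borel_measurable_integrable[OF Y]
  obtain \<delta> where \<delta>: "\<delta> > 0" "\<And>Y. integrable M Y \<Longrightarrow>
      (\<And>A. A \<in> \<pi> \<Longrightarrow> \<bar>(\<integral>x. Y x * indicator A x \<partial>M) - (\<integral>x. X x * indicator A x \<partial>M)\<bar> < \<delta>) \<Longrightarrow>
      l < \<rho> (partition_mean M \<pi> Y)"
    using partition_mean_nhd[OF \<pi> X l] by metis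
  let ?tail = "\<lambda>Z k. {x \<in> space M. \<bar>Z x\<bar> > real k}"
  \<comment> \<open>Three errors of at most \<open>\<delta> / 4\<close> arise: rounding off the
    tail, the tail mean, and \<open>X\<close> itself on the tail.\<close>
  let ?e = "\<delta> / 4"
  have "\<forall>\<^sub>F k in sequentially. (\<integral>x. \<bar>X x\<bar> * indicator (?tail X k) x \<partial>M) < \<delta> / 4"
    using order_tendstoD(2)[OF tendsto_tail_integral[OF X], of "\<delta> / 4"] \<delta>(1) by simp
  then obtain k :: nat where k: "(\<integral>x. \<bar>X x\<bar> * indicator (?tail X k) x \<partial>M) < \<delta> / 4"
    by (auto simp: eventually_sequentially)
  define h where "h r = (if \<bar>r\<bar> > real k then None else Some \<lfloor>r / ?e\<rfloor>)" for r
  have h: "discretization (?tail Z k) Z ?e x = h (Z x)" if "x \<in> space M" for Z x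
    using that by (simp add: discretization_def h_def)
  have level: "{y \<in> space M. discretization (?tail Z k) Z ?e y = discretization (?tail Z k) Z ?e x} =
      {y \<in> space M. h (Z y) = h (Z x)}" if "x \<in> space M" for Z x
    using h that by auto
  have hm: "h \<in> measurable borel (count_space UNIV)"
    unfolding h_def[abs_def] by measurable
  have disc: "\<exists>\<pi>'. \<pi>' \<in> finite_partitions M \<and>
      (AE x in M. partition_mean M \<pi>' Z x = set_mean M {y \<in> space M. h (Z y) = h (Z x)} Z) \<and>
      (AE x in M. x \<in> ?tail Z k \<longrightarrow> partition_mean M \<pi>' Z x = set_mean M (?tail Z k) Z) \<and>
      (AE x in M. x \<notin> ?tail Z k \<longrightarrow> \<bar>partition_mean M \<pi>' Z x - Z x\<bar> \<le> ?e)"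
    if Z: "integrable M Z" for Z
  proof -
    note [measurable] = borel_measurable_integrable[OF Z]
    have T: "?tail Z k \<in> sets M" by measurable
    obtain \<pi>' where \<pi>': "\<pi>' \<in> finite_partitions M"
      "AE x in M. partition_mean M \<pi>' Z x = set_mean M {y \<in> space M. discretization (?tail Z k) Z ?e y =
        discretization (?tail Z k) Z ?e x} Z"
      "AE x in M. x \<in> ?tail Z k \<longrightarrow> partition_mean M \<pi>' Z x = set_mean M (?tail Z k) Z"
      "AE x in M. x \<notin> ?tail Z k \<longrightarrow> \<bar>partition_mean M \<pi>' Z x - Z x\<bar> \<le> ?e"
      by (rule discretize[OF Z T, of "real k" ?e]) (use \<delta>(1) in auto)
    have "AE x in M. partition_mean M \<pi>' Z x = set_mean M {y \<in> space M. h (Z y) = h (Z x)} Z"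
      using \<pi>'(2) AE_space by eventually_elim (simp only: level)
    with \<pi>' show ?thesis by blast
  qed
  obtain \<pi>1 where \<pi>1: "\<pi>1 \<in> finite_partitions M"
    "AE x in M. partition_mean M \<pi>1 X x = set_mean M {y \<in> space M. h (X y) = h (X x)} X"
    "AE x in M. x \<in> ?tail X k \<longrightarrow> partition_mean M \<pi>1 X x = set_mean M (?tail X k) X"
    "AE x in M. x \<notin> ?tail X k \<longrightarrow> \<bar>partition_mean M \<pi>1 X x - X x\<bar> \<le> ?e"
    using disc[OF X] by blast
  \<comment> \<open>For \<open>Y\<close> no closeness estimate is kept; only the shape of the
    discretization, with the same \<open>h\<close>, enters.\<close>
  obtain \<pi>2 where \<pi>2: "\<pi>2 \<in> finite_partitions M"
    "AE x in M. partition_mean M \<pi>2 Y x = set_mean M {y \<in> space M. h (Y y) = h (Y x)} Y"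
    using disc[OF Y] by blast
  let ?X = "partition_mean M \<pi>1 X"
  let ?T = "?tail X k"
  have intX1: "integrable M ?X" by (rule integrable_D[OF partition_mean_in_D[OF \<pi>1(1)]])
  have T: "?T \<in> sets M" by measurable
  have ints: "integrable M (\<lambda>x. \<bar>X x\<bar> * indicator ?T x)" using X T by (intro integrable_real_mult_indicator) auto
  define s where "s = \<bar>set_mean M ?T X\<bar>"
  have ints': "integrable M (\<lambda>x. s * indicator ?T x)" by (rule integrable_real_mult_indicator[OF T]) simp
  have s: "s * prob ?T \<le> \<delta> / 4"
  proof -
    have "s * prob ?T \<le> \<bar>\<integral>x. X x * indicator ?T x \<partial>M\<bar>"
      by (simp add: s_def set_mean_def abs_divide)
    also have "\<dots> \<le> (\<integral>x. \<bar>X x * indicator ?T x\<bar> \<partial>M)" by (rule integral_abs_bound)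
    also have "\<dots> = (\<integral>x. \<bar>X x\<bar> * indicator ?T x \<partial>M)" by (simp add: abs_mult)
    finally show ?thesis using k by simp
  qed
  have "\<bar>(\<integral>x. ?X x * indicator A x \<partial>M) - (\<integral>x. X x * indicator A x \<partial>M)\<bar> < \<delta>" if "A \<in> \<pi>" for A
  proof -
    have A: "A \<in> sets M" using finite_partitionsD(2)[OF \<pi> that] .
    note int = integrable_real_mult_indicator[OF A]
    have "\<bar>(\<integral>x. ?X x * indicator A x \<partial>M) - (\<integral>x. X x * indicator A x \<partial>M)\<bar> =
        \<bar>\<integral>x. ?X x * indicator A x - X x * indicator A x \<partial>M\<bar>"
      using int[OF intX1] int[OF X] by simp
    also have "\<dots> \<le> (\<integral>x. \<bar>?X x * indicator A x - X x * indicator A x\<bar> \<partial>M)"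
      by (rule integral_abs_bound)
    also have "\<dots> \<le> (\<integral>x. ?e + (s * indicator ?T x + \<bar>X x\<bar> * indicator ?T x) \<partial>M)"
    proof (rule integral_mono_AE)
      show "integrable M (\<lambda>x. \<bar>?X x * indicator A x - X x * indicator A x\<bar>)"
        using int[OF intX1] int[OF X] by simp
      show "integrable M (\<lambda>x. ?e + (s * indicator ?T x + \<bar>X x\<bar> * indicator ?T x))"
        by (intro Bochner_Integration.integrable_add ints ints') simp
      show "AE x in M. \<bar>?X x * indicator A x - X x * indicator A x\<bar> \<le>
          ?e + (s * indicator ?T x + \<bar>X x\<bar> * indicator ?T x)"
        using \<pi>1(3,4)
      proof eventually_elim
        case (elim x)
        have "\<bar>?X x - X x\<bar> \<le> ?e + (s * indicator ?T x + \<bar>X x\<bar> * indicator ?T x)"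
        proof (cases "x \<in> ?T")
          case True
          then have "?X x = set_mean M ?T X" using elim by blast
          then have "\<bar>?X x - X x\<bar> \<le> s + \<bar>X x\<bar>" unfolding s_def by linarith
          then show ?thesis using True \<delta>(1) by simp
        next
          case False
          then have "\<bar>?X x - X x\<bar> \<le> ?e" using elim by blast
          moreover have "indicator ?T x = (0 :: real)" using False by (rule indicator_simps(2))
          ultimately show ?thesis by simp
        qed
        moreover have "\<bar>?X x * indicator A x - X x * indicator A x\<bar> \<le> \<bar>?X x - X x\<bar>"
          by (simp add: indicator_def)
        ultimately show ?case by (rule order_trans[rotated])
      qed
    qed
    also have "\<dots> = ?e + (s * prob ?T + (\<integral>x. \<bar>X x\<bar> * indicator ?T x \<partial>M))"
      using ints ints' T by (simp add: prob_space Bochner_Integration.integral_add)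
    also have "\<dots> < \<delta>" using s k \<delta>(1) by simp
    finally show ?thesis .
  qed
  then have "l < \<rho> (partition_mean M \<pi> ?X)" by (intro \<delta>(2) intX1)
  also have "\<dots> \<le> \<rho> ?X" by (rule partition_mean_le[OF \<pi> partition_mean_in_D[OF \<pi>1(1)]])
  also have "\<dots> = \<rho> (partition_mean M \<pi>2 Y)"
    by (rule discretized_law[OF X Y law partition_mean_in_D[OF \<pi>1(1)] \<pi>1(2) partition_mean_in_D[OF \<pi>2(1)] \<pi>2(2) hm])
  also have "\<dots> \<le> dilatation_extension M \<rho> Y" by (rule le_extension[OF Y \<pi>2(1)])
  finally show "l \<le> dilatation_extension M \<rho> Y" by simp
qed

section \<open>Properties inherited partition by partition\<close>

lemma extension_not_MInf:
  assumes X: "integrable M X"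
  shows "dilatation_extension M \<rho> X \<noteq> -\<infinity>"
proof -
  \<comment> \<open>The trivial partition bounds the supremum below by a value of
    \<open>\<rho>\<close> on the domain.\<close>
  have \<pi>: "{space M} \<in> finite_partitions M"
    using not_empty by (auto simp: finite_partitions_def partition_on_def prob_space)
  show ?thesis
    using le_extension[OF X \<pi>] not_MInf[OF partition_mean_in_D[OF \<pi>, of X]] by auto
qed

text \<open>Cell means are linear in the variable, so the inequality holds for each partition
  separately; the right side is then enlarged to the suprema.\<close>

lemma extension_quasiconvex: "quasiconvex_functional (L1_space M) (dilatation_extension M \<rho>)"
  unfolding quasiconvex_functional_def L1_space_def
proof (intro ballI allI impI, elim conjE, unfold mem_Collect_eq)
  fix X Y :: "'a \<Rightarrow> real" and l :: real
  assume X: "integrable M X" and Y: "integrable M Y" and l: "0 < l" "l < 1"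
    and XY: "integrable M (\<lambda>x. l * X x + (1 - l) * Y x)"
  show "dilatation_extension M \<rho> (\<lambda>x. l * X x + (1 - l) * Y x) \<le>
      max (dilatation_extension M \<rho> X) (dilatation_extension M \<rho> Y)"
  proof (rule extension_le[OF XY])
    fix \<pi> assume \<pi>: "\<pi> \<in> finite_partitions M"
    have eq: "partition_mean M \<pi> (\<lambda>x. l * X x + (1 - l) * Y x) =
        (\<lambda>x. l * partition_mean M \<pi> X x + (1 - l) * partition_mean M \<pi> Y x)"
      using partition_mean_linear[OF \<pi> X Y] by (intro ext)
    have "\<rho> (partition_mean M \<pi> (\<lambda>x. l * X x + (1 - l) * Y x)) \<le>
        max (\<rho> (partition_mean M \<pi> X)) (\<rho> (partition_mean M \<pi> Y))"
      using quasiconvex[unfolded quasiconvex_functional_def, rule_format,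
          OF partition_mean_in_D[OF \<pi>, of X] partition_mean_in_D[OF \<pi>, of Y], of l]
        l partition_mean_in_D[OF \<pi>, of "\<lambda>x. l * X x + (1 - l) * Y x"] unfolding eq by blast
    also have "\<dots> \<le> max (dilatation_extension M \<rho> X) (dilatation_extension M \<rho> Y)"
      by (intro max.mono le_extension X Y \<pi>)
    finally show "\<rho> (partition_mean M \<pi> (\<lambda>x. l * X x + (1 - l) * Y x)) \<le> \<dots>" .
  qed
qed

lemma extension_convex:
  assumes "convex_functional D \<rho>"
  shows "convex_functional (L1_space M) (dilatation_extension M \<rho>)"
  unfolding convex_functional_def L1_space_def
proof (intro ballI allI impI, elim conjE, unfold mem_Collect_eq)
  fix X Y :: "'a \<Rightarrow> real" and l :: real
  assume X: "integrable M X" and Y: "integrable M Y" and l: "0 < l" "l < 1"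
    and XY: "integrable M (\<lambda>x. l * X x + (1 - l) * Y x)"
  show "dilatation_extension M \<rho> (\<lambda>x. l * X x + (1 - l) * Y x) \<le>
      ereal l * dilatation_extension M \<rho> X + ereal (1 - l) * dilatation_extension M \<rho> Y"
  proof (rule extension_le[OF XY])
    fix \<pi> assume \<pi>: "\<pi> \<in> finite_partitions M"
    have eq: "partition_mean M \<pi> (\<lambda>x. l * X x + (1 - l) * Y x) =
        (\<lambda>x. l * partition_mean M \<pi> X x + (1 - l) * partition_mean M \<pi> Y x)"
      using partition_mean_linear[OF \<pi> X Y] by (intro ext)
    have "\<rho> (partition_mean M \<pi> (\<lambda>x. l * X x + (1 - l) * Y x)) \<le>
        ereal l * \<rho> (partition_mean M \<pi> X) + ereal (1 - l) * \<rho> (partition_mean M \<pi> Y)"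
      using assms[unfolded convex_functional_def, rule_format,
          OF partition_mean_in_D[OF \<pi>, of X] partition_mean_in_D[OF \<pi>, of Y], of l]
        l partition_mean_in_D[OF \<pi>, of "\<lambda>x. l * X x + (1 - l) * Y x"] unfolding eq by blast
    also have "\<dots> \<le> ereal l * dilatation_extension M \<rho> X + ereal (1 - l) * dilatation_extension M \<rho> Y"
      using l by (intro add_mono ereal_mult_left_mono le_extension X Y \<pi>) auto
    finally show "\<rho> (partition_mean M \<pi> (\<lambda>x. l * X x + (1 - l) * Y x)) \<le> \<dots>" .
  qed
qed

lemma extension_monotone:
  assumes "monotone_functional M D \<rho>"
  shows "monotone_functional M (L1_space M) (dilatation_extension M \<rho>)"
  unfolding monotone_functional_def L1_space_def
proof (intro ballI impI, unfold mem_Collect_eq)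
  fix X Y :: "'a \<Rightarrow> real"
  assume X: "integrable M X" and Y: "integrable M Y" and le: "AE x in M. Y x \<le> X x"
  show "dilatation_extension M \<rho> X \<le> dilatation_extension M \<rho> Y"
  proof (rule extension_le[OF X])
    fix \<pi> assume \<pi>: "\<pi> \<in> finite_partitions M"
    have "AE x in M. partition_mean M \<pi> Y x \<le> partition_mean M \<pi> X x"
      using partition_mean_mono[OF \<pi> Y X le] by simp
    then have "\<rho> (partition_mean M \<pi> X) \<le> \<rho> (partition_mean M \<pi> Y)"
      using assms partition_mean_in_D[OF \<pi>] unfolding monotone_functional_def by blast
    also have "\<dots> \<le> dilatation_extension M \<rho> Y" by (rule le_extension[OF Y \<pi>])
    finally show "\<rho> (partition_mean M \<pi> X) \<le> dilatation_extension M \<rho> Y" .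
  qed
qed

text \<open>One inequality for all shifts suffices: applied to \<open>X + s\<close> and the shift
  \<open>- s\<close> it gives the other.\<close>

lemma extension_cash_additive:
  assumes ca: "cash_additive D \<rho>"
  shows "cash_additive (L1_space M) (dilatation_extension M \<rho>)"
  unfolding cash_additive_def L1_space_def
proof (intro ballI allI impI, unfold mem_Collect_eq)
  have le: "dilatation_extension M \<rho> (\<lambda>x. X x + s) \<le> dilatation_extension M \<rho> X - ereal s"
    if X: "integrable M X" for X s
  proof (rule extension_le)
    show "integrable M (\<lambda>x. X x + s)" using X by simp
    fix \<pi> assume \<pi>: "\<pi> \<in> finite_partitions M"
    \<comment> \<open>The two sides can differ outside the space, where cell means are 0, so the
      equality is used almost surely through \<open>cong_AE\<close>.\<close>
    have "partition_mean M \<pi> X x + s = partition_mean M \<pi> (\<lambda>x. X x + s) x" if "x \<in> space M" for x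
      using partition_mean_linear[OF \<pi> X integrable_const, of 1 1 s x] partition_mean_const[OF \<pi> that, of s] by simp
    then have AE: "AE x in M. partition_mean M \<pi> (\<lambda>x. X x + s) x = partition_mean M \<pi> X x + s" by simp
    note eq = cong_AE[OF partition_mean_in_D[OF \<pi>] _ AE]
    have meas: "(\<lambda>x. partition_mean M \<pi> X x + s) \<in> borel_measurable M"
      using measurable_D[OF partition_mean_in_D[OF \<pi>, of X]] by simp
    have "\<rho> (\<lambda>x. partition_mean M \<pi> X x + s) = \<rho> (partition_mean M \<pi> X) - ereal s"
      using ca partition_mean_in_D[OF \<pi>, of X] eq(1)[OF meas] unfolding cash_additive_def by blast
    then have "\<rho> (partition_mean M \<pi> (\<lambda>x. X x + s)) = \<rho> (partition_mean M \<pi> X) - ereal s"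
      using eq(2)[OF meas] by simp
    also have "\<dots> \<le> dilatation_extension M \<rho> X - ereal s"
      by (intro ereal_minus_mono le_extension X \<pi>) simp
    finally show "\<rho> (partition_mean M \<pi> (\<lambda>x. X x + s)) \<le> dilatation_extension M \<rho> X - ereal s" .
  qed
  fix X :: "'a \<Rightarrow> real" and s assume X: "integrable M X"
  have "dilatation_extension M \<rho> X \<le> dilatation_extension M \<rho> (\<lambda>x. X x + s) - ereal (- s)"
    using le[of "\<lambda>x. X x + s" "- s"] X by simp
  with le[OF X, of s] show "dilatation_extension M \<rho> (\<lambda>x. X x + s) = dilatation_extension M \<rho> X - ereal s"
    by (cases "dilatation_extension M \<rho> X"; cases "dilatation_extension M \<rho> (\<lambda>x. X x + s)") auto
qed

lemma extension_law_invariant: "law_invariant M (L1_space M) (dilatation_extension M \<rho>)"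
  unfolding law_invariant_def L1_space_def
  by (intro ballI impI antisym) (simp_all add: extension_law_le)

text \<open>The conditional expectation lies in the domain, where the extension is
  \<open>\<rho>\<close>; its value is thus one term of the supremum for \<open>X\<close>.\<close>

lemma extension_dilatation_monotone: "dilatation_monotone M (L1_space M) (dilatation_extension M \<rho>)"
  unfolding dilatation_monotone_def L1_space_def
proof (intro ballI, unfold mem_Collect_eq)
  fix X :: "'a \<Rightarrow> real" and \<pi> assume X: "integrable M X" and \<pi>: "\<pi> \<in> finite_partitions M"
  show "dilatation_extension M \<rho> (partition_cond_exp M \<pi> X) \<le> dilatation_extension M \<rho> X"
    using extension_on_D[OF partition_cond_exp_eq(1)[OF \<pi> X]] partition_cond_exp_eq(2)[OF \<pi> X]
      le_extension[OF X \<pi>] by simp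
qed

end

theorem corollary6:
  fixes M :: "'a measure"
    and \<X> :: "('a \<Rightarrow> real) set"
    and \<rho> :: "('a \<Rightarrow> real) \<Rightarrow> ereal"
  assumes "prob_space M"
    and "nonatomic M"
    and "\<X> \<subseteq> L1_space M"
    and "convex_rv_set \<X>"
    and "\<And>X Y. X \<in> \<X> \<Longrightarrow> Y \<in> \<X> \<Longrightarrow> (\<lambda>\<omega>. X \<omega> + Y \<omega>) \<in> \<X>"
    and "Linf_space M \<subseteq> \<X>"
    and "\<And>X A. X \<in> \<X> \<Longrightarrow> A \<in> sets M \<Longrightarrow> (\<lambda>\<omega>. X \<omega> * indicator A \<omega>) \<in> \<X>"
    and "\<And>X. X \<in> \<X> \<Longrightarrow> \<rho> X \<noteq> -\<infinity>"
    and "quasiconvex_functional \<X> \<rho>"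
    and "law_invariant M \<X> \<rho>"
    and "fatou_property M \<X> \<rho>"
  shows "(\<forall>X\<in>L1_space M. dilatation_extension M \<rho> X \<noteq> -\<infinity>) \<and>
    (\<forall>X\<in>\<X>. dilatation_extension M \<rho> X = \<rho> X) \<and>
    quasiconvex_functional (L1_space M) (dilatation_extension M \<rho>) \<and>
    law_invariant M (L1_space M) (dilatation_extension M \<rho>) \<and>
    dilatation_monotone M (L1_space M) (dilatation_extension M \<rho>) \<and>
    lower_semicontinuous (weak_L1_topology M) (L1_space M) (dilatation_extension M \<rho>) \<and>
    (monotone_functional M \<X> \<rho> \<longrightarrow>
       monotone_functional M (L1_space M) (dilatation_extension M \<rho>)) \<and>
    (convex_functional \<X> \<rho> \<longrightarrow>
       convex_functional (L1_space M) (dilatation_extension M \<rho>)) \<and>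
    (cash_additive \<X> \<rho> \<longrightarrow>
       cash_additive (L1_space M) (dilatation_extension M \<rho>))"
proof -
  interpret prob_space M by fact
  interpret fatou_functional M \<X> \<rho>
    using assms(2-11) by unfold_locales
  show ?thesis
    using extension_not_MInf extension_on_D extension_quasiconvex extension_law_invariant
      extension_dilatation_monotone extension_weakly_lsc extension_monotone extension_convex
      extension_cash_additive
    by (simp add: L1_space_def)
qed

end
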